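(* Let $(H,\langle\,,\rangle)$ be a polarized integral Hodge structure of weight $2$ with $\dim H^{2,0}=1$, with Clifford algebra $C(H)$ equipped with its induced weight $2$ Hodge structure. Let $W=C(H)^{2,0}\,C(H_{\mathbb{C}})\subset C(H_{\mathbb{C}})$, which gives the weight $1$ decomposition $C(H_{\mathbb{C}})=W\oplus\overline{W}$. Then the complex structure on $C(H_{\mathbb{R}})$ given by the Kuga–Satake construction coincides with the complex structure on $C(H_{\mathbb{R}})$ determined by this weight $1$ decomposition; that is, $W$ is the $i$-eigenspace in $C(H_{\mathbb{C}})$ of the ($\mathbb{C}$-linearly extended) Kuga–Satake complex structure operator.
   Context: A polarized integral Hodge structure of weight $2$ is a lattice $H$ with a decomposition $H_{\mathbb{C}}:=H\otimes\mathbb{C}=H^{2,0}\oplus H^{1,1}\oplus H^{0,2}$, $\overline{H^{2,0}}=H^{0,2}$, $\overline{H^{1,1}}=H^{1,1}$, and an integral symmetric bilinear form $\langle\,,\rangle$ such that the decomposition is orthogonal for $h(\alpha,\beta)=\langle\alpha,\overline{\beta}\rangle$, with $h$ positive definite on $H^{2,0}$ and $H^{0,2}$ and negative definite on $H^{1,1}$. The Clifford algebra $C(H)$ is the quotient of the tensor algebra of $H$ by the two-sided ideal generated by the relations $h\otimes h=-\langle h,h\rangle1$; $C(H_{\mathbb{R}})=C(H)\otimes\mathbb{R}$, $C(H_{\mathbb{C}})=C(H)\otimes\mathbb{C}$. It is canonically identified as a lattice with $\bigwedge H$, with $1\mapsto1$ and left Clifford multiplication by $h\in H$ equal to $h\wedge\,\cdot\,-h\lrcorner\,\cdot$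 ($h\lrcorner$ is contraction with $\langle h,\cdot\rangle\in H^*$). The induced weight $2$ Hodge structure on $C(H)$ is: for every $k$, inside $\bigwedge^kH_{\mathbb{C}}$, $H^{2,0}\wedge\bigwedge^{k-1}H^{1,1}$ has type $(2,0)$, $H^{0,2}\wedge\bigwedge^{k-1}H^{1,1}$ has type $(0,2)$, and $\bigwedge^kH^{1,1}$ and $H^{2,0}\wedge H^{0,2}\wedge\bigwedge^{k-2}H^{1,1}$ have type $(1,1)$. The product $C(H)^{2,0}C(H_{\mathbb{C}})$ is the span of Clifford products; it is known that $C(H_{\mathbb{C}})=W\oplus\overline W$. Kuga–Satake construction: the form $\langle\,,\rangle$ is positive definite on the real $2$-plane $P=(H^{2,0}\oplus H^{0,2})\cap H_{\mathbb{R}}$. Orient $P$ so that $(\mathrm{Re}\,\eta,\mathrm{Im}\,\eta)$ is an oriented basis for $0\neq\eta\in H^{2,0}$. Let $e_1,e_2$ be an oriented orthonormal basis of $P$ and $e:=e_2e_1\in C(H_{\mathbb{R}})$, which is independent of the choice of basis. Then $e^2=-1$, and the Kuga–Satake complex structure operator $I$ on $C(H_{\mathbb{R}})$ is left multiplication by $e$. *)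

theory Defs
  imports
    "HOL-Analysis.Analysis"
    "HOL-Algebra.QuotRing"
    "HOL-Algebra.Algebraic_Closure_Type"
    "HOL-Library.Poly_Mapping"
begin

unbundle no fps_syntax

section \<open>Polarized integral Hodge structures of weight 2\<close>

text \<open>
  A lattice of finite rank is represented, after the choice of a basis, by \<open>int ^ 'n\<close>, so that its
  real and complex scalar extensions are \<open>real ^ 'n\<close> and \<open>complex ^ 'n\<close>.
\<close>

definition form_ext ::
    "(int ^ 'n \<Rightarrow> int ^ 'n \<Rightarrow> int) \<Rightarrow> 'k ^ 'n \<Rightarrow> 'k ^ 'n \<Rightarrow> 'k :: comm_ring_1" where
  "form_ext B v w = (\<Sum>i\<in>UNIV. \<Sum>j\<in>UNIV. v $ i * w $ j * of_int (B (axis i 1) (axis j 1)))"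

definition vec_map :: "('a \<Rightarrow> 'b) \<Rightarrow> 'a ^ 'n \<Rightarrow> 'b ^ 'n" where
  "vec_map f v = (\<chi> i. f (v $ i))"

definition herm :: "(int ^ 'n \<Rightarrow> int ^ 'n \<Rightarrow> int) \<Rightarrow> complex ^ 'n \<Rightarrow> complex ^ 'n \<Rightarrow> complex" where
  "herm B v w = form_ext B v (vec_map cnj w)"

text \<open>
  The values \<open>herm B v v\<close> are automatically real, \<open>B\<close> being symmetric and integral; \<open>Re\<close> is only
  needed to state their sign.
\<close>

locale polarized_hodge_structure =
  fixes B :: "int ^ 'n \<Rightarrow> int ^ 'n \<Rightarrow> int"
    and H20 H11 H02 :: "(complex ^ 'n) set"
  assumes additive: "B (x + y) z = B x z + B y z"
    and symmetric: "B x y = B y x"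
    and subspaces: "vec.subspace H20" "vec.subspace H11" "vec.subspace H02"
    and direct_sum: "\<exists>!(a, b, c). a \<in> H20 \<and> b \<in> H11 \<and> c \<in> H02 \<and> v = a + b + c"
    and conj20: "vec_map cnj ` H20 = H02"
    and conj11: "vec_map cnj ` H11 = H11"
    and orthogonal:
      "a \<in> H20 \<Longrightarrow> b \<in> H11 \<Longrightarrow> herm B a b = 0"
      "a \<in> H20 \<Longrightarrow> c \<in> H02 \<Longrightarrow> herm B a c = 0"
      "b \<in> H11 \<Longrightarrow> c \<in> H02 \<Longrightarrow> herm B b c = 0"
    and positive20: "a \<in> H20 \<Longrightarrow> a \<noteq> 0 \<Longrightarrow> Re (herm B a a) > 0"
    and positive02: "c \<in> H02 \<Longrightarrow> c \<noteq> 0 \<Longrightarrow> Re (herm B c c) > 0"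
    and negative11: "b \<in> H11 \<Longrightarrow> b \<noteq> 0 \<Longrightarrow> Re (herm B b b) < 0"

definition positive_plane :: "(complex ^ 'n) set \<Rightarrow> (complex ^ 'n) set \<Rightarrow> (real ^ 'n) set" where
  "positive_plane H20 H02 = {v. \<exists>a\<in>H20. \<exists>c\<in>H02. vec_map complex_of_real v = a + c}"

definition same_orientation :: "real ^ 'n \<Rightarrow> real ^ 'n \<Rightarrow> real ^ 'n \<Rightarrow> real ^ 'n \<Rightarrow> bool" where
  "same_orientation u v u' v' \<longleftrightarrow>
    (\<exists>p q r s. u' = p *\<^sub>R u + q *\<^sub>R v \<and> v' = r *\<^sub>R u + s *\<^sub>R v \<and> p * s - q * r > 0)"

definition oriented_orthonormal_basis ::
    "(int ^ 'n \<Rightarrow> int ^ 'n \<Rightarrow> int) \<Rightarrow> (complex ^ 'n) set \<Rightarrow> (complex ^ 'n) set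
      \<Rightarrow> real ^ 'n \<Rightarrow> real ^ 'n \<Rightarrow> bool" where
  "oriented_orthonormal_basis B H20 H02 e1 e2 \<longleftrightarrow>
    span {e1, e2} = positive_plane H20 H02 \<and>
    form_ext B e1 e1 = 1 \<and> form_ext B e2 e2 = 1 \<and> form_ext B e1 e2 = 0 \<and>
    (\<forall>\<eta>\<in>H20. \<eta> \<noteq> 0 \<longrightarrow> same_orientation (vec_map Re \<eta>) (vec_map Im \<eta>) e1 e2)"

section \<open>The Clifford algebra\<close>

text \<open>
  The tensor algebra of the free module with basis \<open>'n\<close> over \<open>'k\<close> has the words over \<open>'n\<close> as its
  basis, i.e. it is the monoid algebra \<open>'n list \<Rightarrow>\<^sub>0 'k\<close> of the free monoid: the word
  \<open>[i, j, \<dots>]\<close> stands for the tensor product of the basis vectors \<open>i\<close>, \<open>j\<close>, \<open>\<dots>\<close>, and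
  multiplication is concatenation.
\<close>

instantiation list :: (type) monoid_add
begin

definition "0 = []"

definition "xs + ys = xs @ ys"

instance
  by standard (simp_all add: zero_list_def plus_list_def)

end

type_synonym ('n, 'k) tensor = "'n list \<Rightarrow>\<^sub>0 'k"

abbreviation tensor_algebra :: "('n, 'k :: comm_ring_1) tensor ring" where
  "tensor_algebra \<equiv> ring_of_type_algebra"

definition tensor_scalar :: "'k \<Rightarrow> ('n, 'k :: comm_ring_1) tensor" where
  "tensor_scalar c = Poly_Mapping.single [] c"

definition tensor_vec :: "'k ^ 'n \<Rightarrow> ('n, 'k :: comm_ring_1) tensor" where
  "tensor_vec v = (\<Sum>i\<in>UNIV. Poly_Mapping.single [i] (v $ i))"

text \<open>
  The relations are those of the lattice, imposed over the coefficient ring \<open>'k\<close>. For \<open>'k = int\<close> the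
  quotient is the integral Clifford algebra \<open>C(H)\<close>; in general it is \<open>C(H) \<otimes> 'k\<close>, because tensoring
  is right exact.
\<close>

definition clifford_ideal ::
    "(int ^ 'n \<Rightarrow> int ^ 'n \<Rightarrow> int) \<Rightarrow> ('n, 'k :: comm_ring_1) tensor set" where
  "clifford_ideal B = Idl\<^bsub>tensor_algebra\<^esub>
     {tensor_vec (vec_map of_int h) * tensor_vec (vec_map of_int h) + tensor_scalar (of_int (B h h)) | h. True}"

definition clifford ::
    "(int ^ 'n \<Rightarrow> int ^ 'n \<Rightarrow> int) \<Rightarrow> ('n, 'k :: comm_ring_1) tensor set ring" where
  "clifford B = tensor_algebra Quot clifford_ideal B"

definition clifford_class ::
    "(int ^ 'n \<Rightarrow> int ^ 'n \<Rightarrow> int) \<Rightarrow> ('n, 'k :: comm_ring_1) tensor \<Rightarrow> ('n, 'k) tensor set" where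
  "clifford_class B t = clifford_ideal B +>\<^bsub>tensor_algebra\<^esub> t"

definition clifford_vec ::
    "(int ^ 'n \<Rightarrow> int ^ 'n \<Rightarrow> int) \<Rightarrow> 'k ^ 'n \<Rightarrow> ('n, 'k :: comm_ring_1) tensor set" where
  "clifford_vec B v = clifford_class B (tensor_vec v)"

definition clifford_scale ::
    "(int ^ 'n \<Rightarrow> int ^ 'n \<Rightarrow> int) \<Rightarrow> 'k \<Rightarrow> ('n, 'k :: comm_ring_1) tensor set \<Rightarrow> ('n, 'k) tensor set" where
  "clifford_scale B c x = clifford_class B (tensor_scalar c) \<otimes>\<^bsub>clifford B\<^esub> x"

inductive_set clifford_span ::
    "(int ^ 'n \<Rightarrow> int ^ 'n \<Rightarrow> int) \<Rightarrow> ('n, 'k :: comm_ring_1) tensor set set \<Rightarrow> ('n, 'k) tensor set set"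
  for B S where
  zero: "\<zero>\<^bsub>clifford B\<^esub> \<in> clifford_span B S"
| base: "x \<in> S \<Longrightarrow> x \<in> clifford_span B S"
| add: "x \<in> clifford_span B S \<Longrightarrow> y \<in> clifford_span B S \<Longrightarrow> x \<oplus>\<^bsub>clifford B\<^esub> y \<in> clifford_span B S"
| scale: "x \<in> clifford_span B S \<Longrightarrow> clifford_scale B c x \<in> clifford_span B S"

section \<open>The exterior algebra and the induced Hodge structure\<close>

text \<open>The exterior algebra is the quotient of the tensor algebra by the relations \<open>h \<otimes> h = 0\<close>.\<close>

abbreviation zero_form :: "int ^ 'n \<Rightarrow> int ^ 'n \<Rightarrow> int" where
  "zero_form \<equiv> \<lambda>_ _. 0"

abbreviation exterior :: "('n :: finite, 'k :: comm_ring_1) tensor set ring" where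
  "exterior \<equiv> clifford zero_form"

text \<open>
  Contraction with a linear functional, given by its values \<open>f\<close> on the basis: the antiderivation with
  \<open>f \<lrcorner> (v \<and> \<omega>) = f(v) \<omega> - v \<and> (f \<lrcorner> \<omega>)\<close>. It is defined on tensors by this recursion and passes to the
  exterior algebra.
\<close>

primrec contract_word :: "('n \<Rightarrow> 'k) \<Rightarrow> 'n list \<Rightarrow> ('n, 'k :: comm_ring_1) tensor" where
  "contract_word f [] = 0"
| "contract_word f (i # w) =
     Poly_Mapping.single w (f i) - Poly_Mapping.single [i] 1 * contract_word f w"

definition contract_tensor :: "('n \<Rightarrow> 'k) \<Rightarrow> ('n, 'k :: comm_ring_1) tensor \<Rightarrow> ('n, 'k) tensor" where
  "contract_tensor f t =
     (\<Sum>w\<in>Poly_Mapping.keys t. tensor_scalar (Poly_Mapping.lookup t w) * contract_word f w)"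

definition contraction ::
    "(int ^ 'n \<Rightarrow> int ^ 'n \<Rightarrow> int) \<Rightarrow> 'k ^ 'n \<Rightarrow> ('n, 'k :: comm_ring_1) tensor set \<Rightarrow> ('n, 'k) tensor set"
    where
  "contraction B h x =
     clifford_ideal zero_form <+>\<^bsub>tensor_algebra\<^esub> contract_tensor (\<lambda>i. form_ext B h (axis i 1)) ` x"

text \<open>
  The identification sends \<open>1\<close> to \<open>1\<close> and turns \<open>h \<and> _ - h \<lrcorner> _\<close> into left Clifford
  multiplication by \<open>h\<close>. These two properties and linearity determine it uniquely, because the
  products \<open>h\<^sub>1 \<and> \<dots> \<and> h\<^sub>k\<close> span the exterior algebra.
\<close>

definition exterior_identification ::
    "(int ^ 'n \<Rightarrow> int ^ 'n \<Rightarrow> int) \<Rightarrow> ('n, 'k :: comm_ring_1) tensor set \<Rightarrow> ('n, 'k) tensor set" where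
  "exterior_identification B = (THE \<phi>.
     \<phi> \<in> extensional (carrier exterior) \<and>
     bij_betw \<phi> (carrier exterior) (carrier (clifford B)) \<and>
     (\<forall>x\<in>carrier exterior. \<forall>y\<in>carrier exterior. \<phi> (x \<oplus>\<^bsub>exterior\<^esub> y) = \<phi> x \<oplus>\<^bsub>clifford B\<^esub> \<phi> y) \<and>
     (\<forall>c. \<forall>x\<in>carrier exterior. \<phi> (clifford_scale zero_form c x) = clifford_scale B c (\<phi> x)) \<and>
     \<phi> \<one>\<^bsub>exterior\<^esub> = \<one>\<^bsub>clifford B\<^esub> \<and>
     (\<forall>h. \<forall>x\<in>carrier exterior.
        clifford_vec B h \<otimes>\<^bsub>clifford B\<^esub> \<phi> x =
        \<phi> ((clifford_vec zero_form h \<otimes>\<^bsub>exterior\<^esub> x) \<ominus>\<^bsub>exterior\<^esub> contraction B h x)))"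

definition ext_power :: "nat \<Rightarrow> (complex ^ 'n) set \<Rightarrow> ('n, complex) tensor set set" where
  "ext_power k L = clifford_span zero_form
     {foldr (\<lambda>v x. clifford_vec zero_form v \<otimes>\<^bsub>exterior\<^esub> x) vs \<one>\<^bsub>exterior\<^esub> | vs.
        length vs = k \<and> set vs \<subseteq> L}"

text \<open>The unions run over all exterior degrees of the \<open>H11\<close> factor.\<close>

definition exterior_hodge ::
    "(complex ^ 'n) set \<Rightarrow> (complex ^ 'n) set \<Rightarrow> (complex ^ 'n) set
      \<Rightarrow> nat \<Rightarrow> nat \<Rightarrow> ('n, complex) tensor set set" where
  "exterior_hodge H20 H11 H02 p q = clifford_span zero_form
     (if (p, q) = (2, 0) then
        (\<Union>k. {clifford_vec zero_form a \<otimes>\<^bsub>exterior\<^esub> x | a x. a \<in> H20 \<and> x \<in> ext_power k H11})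
      else if (p, q) = (0, 2) then
        (\<Union>k. {clifford_vec zero_form c \<otimes>\<^bsub>exterior\<^esub> x | c x. c \<in> H02 \<and> x \<in> ext_power k H11})
      else if (p, q) = (1, 1) then
        (\<Union>k. ext_power k H11 \<union>
          {clifford_vec zero_form a \<otimes>\<^bsub>exterior\<^esub> (clifford_vec zero_form c \<otimes>\<^bsub>exterior\<^esub> x) | a c x.
             a \<in> H20 \<and> c \<in> H02 \<and> x \<in> ext_power k H11})
      else {})"

definition clifford_hodge ::
    "(int ^ 'n \<Rightarrow> int ^ 'n \<Rightarrow> int)
      \<Rightarrow> (complex ^ 'n) set \<Rightarrow> (complex ^ 'n) set \<Rightarrow> (complex ^ 'n) set
      \<Rightarrow> nat \<Rightarrow> nat \<Rightarrow> ('n, complex) tensor set set" where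
  "clifford_hodge B H20 H11 H02 p q = exterior_identification B ` exterior_hodge H20 H11 H02 p q"

section \<open>Real structure and the two complex structures\<close>

definition clifford_of_real ::
    "(int ^ 'n \<Rightarrow> int ^ 'n \<Rightarrow> int) \<Rightarrow> ('n, real) tensor set \<Rightarrow> ('n, complex) tensor set" where
  "clifford_of_real B x =
     clifford_ideal B <+>\<^bsub>tensor_algebra\<^esub> Poly_Mapping.map complex_of_real ` x"

text \<open>
  The ideal is generated by tensors with integer coefficients. Hence taking real parts, imaginary parts
  or conjugates of the coefficients of all members of a complex coset gives a coset again.
\<close>

definition clifford_Re :: "('n, complex) tensor set \<Rightarrow> ('n, real) tensor set" where
  "clifford_Re z = Poly_Mapping.map Re ` z"

definition clifford_Im :: "('n, complex) tensor set \<Rightarrow> ('n, real) tensor set" where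
  "clifford_Im z = Poly_Mapping.map Im ` z"

definition clifford_cnj :: "('n, complex) tensor set \<Rightarrow> ('n, complex) tensor set" where
  "clifford_cnj z = Poly_Mapping.map cnj ` z"

definition complex_linear_extension ::
    "(int ^ 'n \<Rightarrow> int ^ 'n \<Rightarrow> int) \<Rightarrow> (('n, real) tensor set \<Rightarrow> ('n, real) tensor set)
      \<Rightarrow> ('n, complex) tensor set \<Rightarrow> ('n, complex) tensor set" where
  "complex_linear_extension B A z =
     clifford_of_real B (A (clifford_Re z)) \<oplus>\<^bsub>clifford B\<^esub>
     clifford_scale B \<i> (clifford_of_real B (A (clifford_Im z)))"

definition kuga_satake ::
    "(int ^ 'n \<Rightarrow> int ^ 'n \<Rightarrow> int) \<Rightarrow> real ^ 'n \<Rightarrow> real ^ 'n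
      \<Rightarrow> ('n, real) tensor set \<Rightarrow> ('n, real) tensor set" where
  "kuga_satake B e1 e2 x =
     (clifford_vec B e2 \<otimes>\<^bsub>clifford B\<^esub> clifford_vec B e1) \<otimes>\<^bsub>clifford B\<^esub> x"

definition weight_one_part ::
    "(int ^ 'n \<Rightarrow> int ^ 'n \<Rightarrow> int)
      \<Rightarrow> (complex ^ 'n) set \<Rightarrow> (complex ^ 'n) set \<Rightarrow> (complex ^ 'n) set
      \<Rightarrow> ('n, complex) tensor set set" where
  "weight_one_part B H20 H11 H02 = clifford_span B
     {x \<otimes>\<^bsub>clifford B\<^esub> y | x y. x \<in> clifford_hodge B H20 H11 H02 2 0 \<and> y \<in> carrier (clifford B)}"

definition weight_one_decomposition ::
    "(int ^ 'n \<Rightarrow> int ^ 'n \<Rightarrow> int) \<Rightarrow> ('n, complex) tensor set set \<Rightarrow> bool" where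
  "weight_one_decomposition B W \<longleftrightarrow>
     W \<subseteq> carrier (clifford B) \<and> clifford_cnj ` W \<subseteq> carrier (clifford B) \<and>
     (\<forall>z\<in>carrier (clifford B).
        \<exists>!(x, y). x \<in> W \<and> y \<in> clifford_cnj ` W \<and> z = x \<oplus>\<^bsub>clifford B\<^esub> y)"

text \<open>
  The complex structure of a weight one decomposition: its complex linear extension is multiplication
  by \<open>\<i>\<close> on \<open>W\<close> and by \<open>-\<i>\<close> on the conjugate of \<open>W\<close>.
\<close>

definition weight_one_structure ::
    "(int ^ 'n \<Rightarrow> int ^ 'n \<Rightarrow> int) \<Rightarrow> ('n, complex) tensor set set
      \<Rightarrow> ('n, real) tensor set \<Rightarrow> ('n, real) tensor set" where
  "weight_one_structure B W x = (THE y. y \<in> carrier (clifford B) \<and>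
     (\<exists>u\<in>W. \<exists>v\<in>clifford_cnj ` W.
        clifford_of_real B x = u \<oplus>\<^bsub>clifford B\<^esub> v \<and>
        clifford_of_real B y = clifford_scale B \<i> u \<oplus>\<^bsub>clifford B\<^esub> clifford_scale B (- \<i>) v))"

end

theory Submission
  imports Defs
begin

text \<open>
  Following Bourbaki, the identification of the exterior with the Clifford algebra lifts to the
  bijection \<open>deform\<close> of the tensor algebra with \<open>deform(v t) = v deform(t) + v \<lrcorner> deform(t)\<close>, whose
  inverse belongs to the negated form. The form pairs \<open>H20\<close> trivially with \<open>H11\<close>, so for \<open>a\<close> in \<open>H20\<close>
  and \<open>\<omega>\<close> in the exterior algebra of \<open>H11\<close> the contraction \<open>a \<lrcorner> \<omega>\<close> vanishes and \<open>a \<and> \<omega>\<close> is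
  sent to the Clifford product of \<open>a\<close> with the image of \<open>\<omega>\<close>. Hence \<open>W\<close> is the right ideal \<open>n C\<close>
  generated by a spanning vector \<open>n\<close> of \<open>H20\<close>, which orthonormality and orientation allow to be
  \<open>e1 + \<i> e2\<close>. Writing \<open>n'\<close> for its conjugate and \<open>e = e2 e1\<close>, the Clifford relations give
  \<open>e n = \<i> n\<close>, \<open>e n' = - \<i> n'\<close> and \<open>n n' + n' n = -4\<close>: the last identity splits the algebra into
  \<open>n C + n' C\<close>, and the first two identify the summands as the eigenspaces of \<open>e\<close>.
\<close>

unbundle no fps_syntax

section \<open>The tensor algebra, contraction and deformation\<close>

lemma single_word_Cons: "Poly_Mapping.single (i # w) c = Poly_Mapping.single [i] 1 * Poly_Mapping.single w (c :: 'k :: comm_ring_1)"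
  by (simp add: mult_single plus_list_def)

lemma tensor_scalar_mult_single: "tensor_scalar c * Poly_Mapping.single w d = Poly_Mapping.single w (c * d)"
  by (simp add: tensor_scalar_def mult_single plus_list_def)

lemma tensor_scalar_one [simp]: "tensor_scalar 1 = 1"
  by (simp add: tensor_scalar_def zero_list_def [symmetric])

lemma single_Nil_one: "Poly_Mapping.single [] 1 = 1"
  by (simp add: zero_list_def [symmetric])

lemma tensor_scalar_zero [simp]: "tensor_scalar 0 = 0"
  by (simp add: tensor_scalar_def)

lemma tensor_scalar_numeral: "tensor_scalar (numeral k) = numeral k"
  by (simp add: tensor_scalar_def zero_list_def [symmetric])

lemma tensor_scalar_add: "tensor_scalar (c + d) = tensor_scalar c + tensor_scalar d"
  by (simp add: tensor_scalar_def single_add)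

lemma tensor_scalar_uminus: "tensor_scalar (- c) = - tensor_scalar c"
  by (simp add: tensor_scalar_def single_uminus)

lemma tensor_scalar_diff: "tensor_scalar (c - d) = tensor_scalar c - tensor_scalar d"
  by (simp add: tensor_scalar_def single_diff)

lemma tensor_scalar_mult: "tensor_scalar (c * d) = tensor_scalar c * tensor_scalar d"
  by (simp add: tensor_scalar_def mult_single plus_list_def)

lemma tensor_scalar_sum: "tensor_scalar (sum f A) = (\<Sum>x\<in>A. tensor_scalar (f x))"
  by (induction A rule: infinite_finite_induct) (simp_all add: tensor_scalar_add)

text \<open>A tensor is the finite sum of its monomials. The empty sum falls under the monomial case
  with coefficient 0, whatever the word.\<close>

lemma tensor_singles_induct [case_names single add]:
  assumes single: "\<And>w c. P (Poly_Mapping.single w c)"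
    and add: "\<And>s t. P s \<Longrightarrow> P t \<Longrightarrow> P (s + t)"
  shows "P (t :: ('n, 'k :: comm_ring_1) tensor)"
proof -
  have "P (\<Sum>w\<in>A. Poly_Mapping.single w (Poly_Mapping.lookup t w))" if "finite A" for A
    using that
  proof induction
    case empty
    then show ?case using single [of undefined 0] by simp
  qed (simp add: single add)
  moreover have "(\<Sum>w\<in>Poly_Mapping.keys t. Poly_Mapping.single w (Poly_Mapping.lookup t w)) = t"
    by (rule poly_mapping_eqI)
      (simp add: lookup_sum lookup_single when_def in_keys_iff)
  ultimately show ?thesis
    by (metis finite_keys)
qed

text \<open>Words are built up by left multiplication with generators. This matches the recursions
  for contraction and deformation, which both describe what happens to a generator on the
  left.\<close>

lemma tensor_induct [case_names one scale add gen]: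
  assumes one: "P 1"
    and scale: "\<And>c t. P t \<Longrightarrow> P (tensor_scalar c * t)"
    and add: "\<And>s t. P s \<Longrightarrow> P t \<Longrightarrow> P (s + t)"
    and gen: "\<And>i t. P t \<Longrightarrow> P (Poly_Mapping.single [i] 1 * t)"
  shows "P (t :: ('n, 'k :: comm_ring_1) tensor)"
proof (induction t rule: tensor_singles_induct)
  case (single w c)
  have "P (Poly_Mapping.single w 1)"
  proof (induction w)
    case Nil
    then show ?case using one by (simp add: zero_list_def [symmetric])
  next
    case (Cons i w)
    then show ?case by (subst single_word_Cons) (rule gen)
  qed
  from scale [OF this, of c] show ?case
    by (simp add: tensor_scalar_mult_single)
qed (rule add)

lemma tensor_scalar_commute: "t * tensor_scalar c = tensor_scalar c * t"
  by (induction t rule: tensor_singles_induct)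
    (simp_all add: tensor_scalar_def mult_single plus_list_def mult.commute algebra_simps)

lemma tensor_scalar_left_commute: "t * (tensor_scalar c * s) = tensor_scalar c * (t * s)"
  by (simp add: tensor_scalar_commute mult.assoc [symmetric])

text \<open>
  As a rewrite rule, \<open>tensor_scalar_left_commute\<close> loops on products of two scalars; the next two
  instances do not.
\<close>

lemma gen_scalar_left_commute:
  "Poly_Mapping.single [i] 1 * (tensor_scalar c * s) = tensor_scalar c * (Poly_Mapping.single [i] 1 * s)"
  by (rule tensor_scalar_left_commute)

lemma tensor_vec_scalar_left_commute:
  "tensor_vec v * (tensor_scalar c * s) = tensor_scalar c * (tensor_vec v * s)"
  by (rule tensor_scalar_left_commute)

section \<open>Tensors of degree one\<close>

lemma tensor_vec_conv_gens: "tensor_vec v = (\<Sum>i\<in>UNIV. tensor_scalar (v $ i) * Poly_Mapping.single [i] 1)"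
  by (simp add: tensor_vec_def tensor_scalar_mult_single)

lemma tensor_vec_axis: "tensor_vec (axis i 1) = Poly_Mapping.single [i] 1"
proof -
  have "tensor_vec (axis i 1) = (\<Sum>j\<in>UNIV. if j = i then Poly_Mapping.single [i] 1 else 0)"
    unfolding tensor_vec_def by (rule sum.cong) (auto simp: axis_def)
  then show ?thesis by simp
qed

lemma tensor_vec_add: "tensor_vec (v + w) = tensor_vec v + tensor_vec w"
  by (simp add: tensor_vec_def single_add sum.distrib)

lemma tensor_vec_scale: "tensor_vec (c *s v) = tensor_scalar c * tensor_vec v"
  by (simp add: tensor_vec_def tensor_scalar_mult_single sum_distrib_left)

text \<open>The linear map with prescribed values on the basis of words. Contraction and
  \<open>deform\<close> are both of this shape, so their linearity is proved once.\<close>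

definition linear_ext :: "('n list \<Rightarrow> ('n, 'k) tensor) \<Rightarrow> ('n, 'k :: comm_ring_1) tensor \<Rightarrow> ('n, 'k) tensor" where
  "linear_ext g t = (\<Sum>w\<in>Poly_Mapping.keys t. tensor_scalar (Poly_Mapping.lookup t w) * g w)"

text \<open>Supports differ from tensor to tensor; a common finite superset lets sums over them be
  added term by term.\<close>

lemma linear_ext_superset:
  assumes "finite A" "Poly_Mapping.keys t \<subseteq> A"
  shows "linear_ext g t = (\<Sum>w\<in>A. tensor_scalar (Poly_Mapping.lookup t w) * g w)"
  unfolding linear_ext_def
  by (rule sum.mono_neutral_left) (use assms in \<open>auto simp: in_keys_iff\<close>)

lemma linear_ext_add: "linear_ext g (s + t) = linear_ext g s + linear_ext g t"
proof -
  let ?A = "Poly_Mapping.keys s \<union> Poly_Mapping.keys t"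
  have "Poly_Mapping.keys (s + t) \<subseteq> ?A" by (rule Poly_Mapping.keys_add)
  then show ?thesis
    by (simp add: linear_ext_superset [of ?A] lookup_add tensor_scalar_add distrib_right sum.distrib)
qed

lemma linear_ext_single: "linear_ext g (Poly_Mapping.single w c) = tensor_scalar c * g w"
  by (simp add: linear_ext_def)

lemma linear_ext_scale: "linear_ext g (tensor_scalar c * t) = tensor_scalar c * linear_ext g t"
proof (induction t rule: tensor_singles_induct)
  case (single w d)
  then show ?case
    by (simp add: tensor_scalar_mult_single linear_ext_single tensor_scalar_mult mult.assoc)
qed (simp add: linear_ext_add distrib_left)

section \<open>Contraction of tensors with a linear functional\<close>

lemma contract_tensor_conv_linear_ext: "contract_tensor f = linear_ext (contract_word f)"
  by (simp add: fun_eq_iff contract_tensor_def linear_ext_def)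

lemma contract_tensor_add: "contract_tensor f (s + t) = contract_tensor f s + contract_tensor f t"
  by (simp add: contract_tensor_conv_linear_ext linear_ext_add)

lemma contract_tensor_scale: "contract_tensor f (tensor_scalar c * t) = tensor_scalar c * contract_tensor f t"
  by (simp add: contract_tensor_conv_linear_ext linear_ext_scale)

lemma contract_tensor_zero [simp]: "contract_tensor f 0 = 0"
  by (simp add: contract_tensor_def)

lemma contract_tensor_one [simp]: "contract_tensor f 1 = 0"
  using linear_ext_single [of "contract_word f" "[]" 1]
  by (simp add: contract_tensor_conv_linear_ext single_Nil_one)

lemma contract_tensor_uminus: "contract_tensor f (- t) = - contract_tensor f t"
  using contract_tensor_scale [of f "-1" t] by (simp add: tensor_scalar_uminus)

lemma contract_tensor_diff: "contract_tensor f (s - t) = contract_tensor f s - contract_tensor f t"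
  using contract_tensor_add [of f s "- t"] by (simp add: contract_tensor_uminus)

lemma contract_tensor_gen:
  "contract_tensor f (Poly_Mapping.single [i] 1 * t) =
     tensor_scalar (f i) * t - Poly_Mapping.single [i] 1 * contract_tensor f t"
proof (induction t rule: tensor_singles_induct)
  case (single w c)
  have "contract_tensor f (Poly_Mapping.single [i] 1 * Poly_Mapping.single w c) =
      tensor_scalar c * contract_word f (i # w)"
    by (simp only: single_word_Cons [symmetric] contract_tensor_conv_linear_ext linear_ext_single)
  also have "\<dots> = tensor_scalar (f i) * Poly_Mapping.single w c -
      Poly_Mapping.single [i] 1 * (tensor_scalar c * contract_word f w)"
    by (simp add: right_diff_distrib tensor_scalar_mult_single gen_scalar_left_commute mult.commute)
  finally show ?case
    by (simp add: contract_tensor_conv_linear_ext linear_ext_single)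
qed (simp add: contract_tensor_add algebra_simps)

lemma contract_tensor_sum: "contract_tensor f (sum g A) = (\<Sum>x\<in>A. contract_tensor f (g x))"
  by (induction A rule: infinite_finite_induct) (simp_all add: contract_tensor_add)

lemma contract_tensor_vec:
  "contract_tensor f (tensor_vec v * t) =
     tensor_scalar (\<Sum>i\<in>UNIV. v $ i * f i) * t - tensor_vec v * contract_tensor f t"
  by (simp add: tensor_vec_conv_gens sum_distrib_right contract_tensor_sum mult.assoc
      contract_tensor_scale contract_tensor_gen right_diff_distrib sum_subtractf
      tensor_scalar_sum tensor_scalar_mult)

lemma contract_tensor_functional_add:
  "contract_tensor (\<lambda>j. f j + g j) t = contract_tensor f t + contract_tensor g t"
  by (induction t rule: tensor_induct)
    (simp_all add: contract_tensor_add contract_tensor_scale contract_tensor_gen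
      tensor_scalar_add algebra_simps)

lemma contract_tensor_functional_scale:
  "contract_tensor (\<lambda>j. c * f j) t = tensor_scalar c * contract_tensor f t"
proof (induction t rule: tensor_induct)
  case (scale d t)
  then show ?case
    using tensor_scalar_left_commute [of "tensor_scalar d" c "contract_tensor f t"]
    by (simp add: contract_tensor_scale)
qed (simp_all add: contract_tensor_add contract_tensor_gen
      tensor_scalar_mult right_diff_distrib distrib_left mult.assoc gen_scalar_left_commute)

lemma contract_tensor_functional_zero: "contract_tensor (\<lambda>j. 0) t = 0"
  using contract_tensor_functional_scale [of 0 "\<lambda>_. 0" t] by simp

lemma contract_tensor_functional_uminus:
  "contract_tensor (\<lambda>j. - f j) t = - contract_tensor f t"
  using contract_tensor_functional_scale [of "-1" f t] by (simp add: tensor_scalar_uminus)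

lemma contract_tensor_functional_sum:
  "contract_tensor (\<lambda>j. \<Sum>i\<in>A. f i j) t = (\<Sum>i\<in>A. contract_tensor (f i) t)"
  by (induction A rule: infinite_finite_induct)
    (simp_all add: contract_tensor_functional_add contract_tensor_functional_zero)

text \<open>For a generator on the left, the terms free of that generator are the multiples of
  single contractions by \<open>f i\<close> and \<open>g i\<close>, and they are antisymmetric in
  \<open>f\<close> and \<open>g\<close>; the rest is the induction hypothesis.\<close>

lemma contract_tensor_anticommute:
  "contract_tensor f (contract_tensor g t) = - contract_tensor g (contract_tensor f t)"
proof (induction t rule: tensor_induct)
  case (gen i t)
  then show ?case
    by (simp add: contract_tensor_gen contract_tensor_diff contract_tensor_scale)
qed (simp_all add: contract_tensor_add contract_tensor_scale)

text \<open>Anticommutation with \<open>g = f\<close> only gives that twice the square vanishes,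
  which is too weak over a general commutative ring; hence a separate induction.\<close>

lemma contract_tensor_contract_tensor [simp]: "contract_tensor f (contract_tensor f t) = 0"
proof (induction t rule: tensor_induct)
  case (gen i t)
  then show ?case
    by (simp add: contract_tensor_gen contract_tensor_diff contract_tensor_scale)
qed (simp_all add: contract_tensor_add contract_tensor_scale)

section \<open>Deformation of the tensor algebra by a bilinear form with matrix
  \<open>M\<close>\<close>

primrec deform_word :: "('n \<Rightarrow> 'n \<Rightarrow> 'k) \<Rightarrow> 'n list \<Rightarrow> ('n, 'k :: comm_ring_1) tensor" where
  "deform_word M [] = 1"
| "deform_word M (i # w) =
     Poly_Mapping.single [i] 1 * deform_word M w + contract_tensor (M i) (deform_word M w)"

definition deform :: "('n \<Rightarrow> 'n \<Rightarrow> 'k) \<Rightarrow> ('n, 'k :: comm_ring_1) tensor \<Rightarrow> ('n, 'k) tensor" where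
  "deform M = linear_ext (deform_word M)"

lemma deform_add: "deform M (s + t) = deform M s + deform M t"
  by (simp add: deform_def linear_ext_add)

lemma deform_scale: "deform M (tensor_scalar c * t) = tensor_scalar c * deform M t"
  by (simp add: deform_def linear_ext_scale)

lemma deform_zero [simp]: "deform M 0 = 0"
  using deform_scale [of M 0 0] by simp

lemma deform_uminus: "deform M (- t) = - deform M t"
  using deform_scale [of M "-1" t] by (simp add: tensor_scalar_uminus)

lemma deform_diff: "deform M (s - t) = deform M s - deform M t"
  using deform_add [of M s "- t"] by (simp add: deform_uminus)

lemma deform_sum: "deform M (sum g A) = (\<Sum>x\<in>A. deform M (g x))"
  by (induction A rule: infinite_finite_induct) (simp_all add: deform_add)

lemma deform_one [simp]: "deform M 1 = 1"
  using linear_ext_single [of "deform_word M" "[]" 1]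
  by (simp add: deform_def single_Nil_one)

lemma deform_gen:
  "deform M (Poly_Mapping.single [i] 1 * t) =
     Poly_Mapping.single [i] 1 * deform M t + contract_tensor (M i) (deform M t)"
proof (induction t rule: tensor_singles_induct)
  case (single w c)
  have "deform M (Poly_Mapping.single [i] 1 * Poly_Mapping.single w c) =
      tensor_scalar c * deform_word M (i # w)"
    by (simp only: single_word_Cons [symmetric] deform_def linear_ext_single)
  then show ?case
    by (simp add: deform_def linear_ext_single contract_tensor_scale distrib_left gen_scalar_left_commute)
qed (simp add: deform_add contract_tensor_add algebra_simps)

text \<open>The functional is \<open>M\<close> with \<open>v\<close> in its first argument. The plus
  sign is the one demanded by the identification \<phi>: from h \<phi>(x) = \<phi>(h \<and> x - h
  \<lrcorner> x) follows \<phi>(h \<and> x) = h \<phi>(x) + \<phi>(h \<lrcorner> x), and \<phi>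
  commutes with contraction.\<close>

lemma deform_vec:
  "deform M (tensor_vec v * t) =
     tensor_vec v * deform M t + contract_tensor (\<lambda>j. \<Sum>i\<in>UNIV. v $ i * M i j) (deform M t)"
  by (simp add: tensor_vec_conv_gens sum_distrib_right deform_sum mult.assoc deform_scale deform_gen
      distrib_left sum.distrib contract_tensor_functional_sum contract_tensor_functional_scale)

text \<open>Moving the contraction by \<open>f\<close> past the contraction by \<open>M i\<close>
  costs the same sign as moving it past the generator \<open>i\<close>, so both terms of
  \<open>deform_gen\<close> behave alike.\<close>

lemma deform_contract_tensor: "deform M (contract_tensor f t) = contract_tensor f (deform M t)"
proof (induction t rule: tensor_induct)
  case (gen i t)
  show ?case
    by (simp add: contract_tensor_gen contract_tensor_add deform_diff deform_scale deform_gen gen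
        contract_tensor_anticommute [of f "M i"])
qed (simp_all add: contract_tensor_add contract_tensor_scale deform_add deform_scale)

text \<open>Since deformation commutes with contraction, the correction terms belonging to
  \<open>M\<close> and to its negative cancel in the step for a generator.\<close>

lemma deform_inverse: "deform (\<lambda>i j. - M i j) (deform M t) = t"
proof (induction t rule: tensor_induct)
  case (gen i t)
  then show ?case
    by (simp add: deform_gen deform_add deform_contract_tensor contract_tensor_functional_uminus)
qed (simp_all add: deform_add deform_scale)

section \<open>The Clifford ideal and its cosets\<close>

lemma ring_of_type_algebra_simps [simp]:
  "carrier ring_of_type_algebra = UNIV"
  "mult ring_of_type_algebra = (*)"
  "add ring_of_type_algebra = (+)"
  "one ring_of_type_algebra = 1"
  "zero ring_of_type_algebra = 0"
  by (simp_all add: ring_of_type_algebra_def fun_eq_iff)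

lemma ring_of_ring_1_type_algebra: "ring (ring_of_type_algebra :: 'a :: ring_1 ring)"
proof -
  have "\<exists>y. x + y = 0" for x :: 'a
    by (rule exI [of _ "- x"]) simp
  moreover have "\<exists>y. y + x = 0" for x :: 'a
    by (rule exI [of _ "- x"]) simp
  ultimately show ?thesis
    by unfold_locales (auto simp: algebra_simps Units_def)
qed

lemma a_inv_ring_of_type_algebra [simp]: "\<ominus>\<^bsub>ring_of_type_algebra\<^esub> (x :: 'a :: ring_1) = - x"
proof -
  interpret ring "ring_of_type_algebra :: 'a ring" by (rule ring_of_ring_1_type_algebra)
  show ?thesis by (rule minus_equality) simp_all
qed

lemma ideal_ring_of_type_algebraI:
  fixes I :: "'a :: ring_1 set"
  assumes "0 \<in> I" "\<And>s t. s \<in> I \<Longrightarrow> t \<in> I \<Longrightarrow> s + t \<in> I"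
    and l: "\<And>s t. t \<in> I \<Longrightarrow> s * t \<in> I" and "\<And>s t. t \<in> I \<Longrightarrow> t * s \<in> I"
  shows "ideal I ring_of_type_algebra"
proof -
  interpret ring "ring_of_type_algebra :: 'a ring" by (rule ring_of_ring_1_type_algebra)
  have "- t \<in> I" if "t \<in> I" for t
    using l [OF that, of "-1"] by simp
  then have "inv\<^bsub>add_monoid ring_of_type_algebra\<^esub> t \<in> I" if "t \<in> I" for t
    using that a_inv_ring_of_type_algebra [of t] by (simp add: a_inv_def)
  then have "subgroup I (add_monoid ring_of_type_algebra)"
    using assms by (intro subgroup.intro) auto
  then show ?thesis
    using assms by (intro idealI ring_of_ring_1_type_algebra) auto
qed

lemma ideal_clifford_ideal: "ideal (clifford_ideal B) tensor_algebra"
  unfolding clifford_ideal_def by (rule ring.genideal_ideal) (simp_all add: ring_of_ring_1_type_algebra)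

section \<open>Closure properties and induction for the Clifford ideal\<close>

context
  fixes B :: "int ^ 'n \<Rightarrow> int ^ 'n \<Rightarrow> int"
begin

lemma clifford_ideal_add: "s \<in> clifford_ideal B \<Longrightarrow> t \<in> clifford_ideal B \<Longrightarrow> s + t \<in> clifford_ideal B"
  using additive_subgroup.a_closed [OF ideal.axioms(1) [OF ideal_clifford_ideal]] by fastforce

lemma clifford_ideal_lmult: "t \<in> clifford_ideal B \<Longrightarrow> s * t \<in> clifford_ideal B"
  using ideal.I_l_closed [OF ideal_clifford_ideal] by fastforce

lemma clifford_ideal_rmult: "t \<in> clifford_ideal B \<Longrightarrow> t * s \<in> clifford_ideal B"
  using ideal.I_r_closed [OF ideal_clifford_ideal] by fastforce

lemma clifford_ideal_zero [simp]: "0 \<in> clifford_ideal B"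
  using additive_subgroup.zero_closed [OF ideal.axioms(1) [OF ideal_clifford_ideal]] by fastforce

lemma clifford_ideal_uminus: "t \<in> clifford_ideal B \<Longrightarrow> - t \<in> clifford_ideal B"
  using clifford_ideal_lmult [of t "-1"] by simp

lemma clifford_ideal_diff: "s \<in> clifford_ideal B \<Longrightarrow> t \<in> clifford_ideal B \<Longrightarrow> s - t \<in> clifford_ideal B"
  using clifford_ideal_add [of s "- t"] by (simp add: clifford_ideal_uminus)

lemma clifford_ideal_sum: "(\<And>x. x \<in> A \<Longrightarrow> f x \<in> clifford_ideal B) \<Longrightarrow> sum f A \<in> clifford_ideal B"
  by (induction A rule: infinite_finite_induct) (simp_all add: clifford_ideal_add)

lemma clifford_ideal_relation:
  "tensor_vec (vec_map of_int h) * tensor_vec (vec_map of_int h) + tensor_scalar (of_int (B h h))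
     \<in> clifford_ideal B"
  unfolding clifford_ideal_def
  by (rule subsetD [OF ring.genideal_self]) (auto simp: ring_of_ring_1_type_algebra)

lemma clifford_ideal_minimal:
  assumes "0 \<in> I" "\<And>s t. s \<in> I \<Longrightarrow> t \<in> I \<Longrightarrow> s + t \<in> I"
    and "\<And>s t. t \<in> I \<Longrightarrow> s * t \<in> I" and "\<And>s t. t \<in> I \<Longrightarrow> t * s \<in> I"
    and "\<And>h. tensor_vec (vec_map of_int h) * tensor_vec (vec_map of_int h)
        + tensor_scalar (of_int (B h h)) \<in> I"
  shows "clifford_ideal B \<subseteq> (I :: ('n, 'k :: comm_ring_1) tensor set)"
  unfolding clifford_ideal_def
  by (rule ring.genideal_minimal [OF ring_of_ring_1_type_algebra ideal_ring_of_type_algebraI])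
    (use assms in auto)

text \<open>The right factor \<open>b\<close> of a relation stays arbitrary, while left factors are
  built up from scalars and generators. Contraction and deformation only have rules for left
  multiplication, so this is the form in which they can be pushed through the ideal.\<close>

lemma clifford_ideal_induct [consumes 1, case_names relation add scale gen]:
  assumes t: "t \<in> clifford_ideal B"
    and relation: "\<And>h b. P ((tensor_vec (vec_map of_int h) * tensor_vec (vec_map of_int h)
        + tensor_scalar (of_int (B h h))) * b)"
    and add: "\<And>s t. P s \<Longrightarrow> P t \<Longrightarrow> P (s + t)"
    and scale: "\<And>c t. P t \<Longrightarrow> P (tensor_scalar c * t)"
    and gen: "\<And>i t. P t \<Longrightarrow> P (Poly_Mapping.single [i] 1 * t)"
  shows "P (t :: ('n, 'k :: comm_ring_1) tensor)"
proof -
  have lmult: "P (a * t)" if "P t" for a t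
    using that
    by (induction a rule: tensor_induct) (simp_all add: add scale gen mult.assoc distrib_right)
  have "P 0"
    using relation [of 0 0] by simp
  \<comment> \<open>Allowing arbitrary factors on both sides makes the set a two-sided ideal, to
    which minimality applies.\<close>
  let ?I = "{t. \<forall>a b. P (a * t * b)}"
  have "clifford_ideal B \<subseteq> ?I"
  proof (rule clifford_ideal_minimal)
    show "0 \<in> ?I" using \<open>P 0\<close> by simp
    show "s + t \<in> ?I" if "s \<in> ?I" "t \<in> ?I" for s t
      using that by (simp add: add distrib_left distrib_right)
    fix h :: "int ^ 'n" and s t
    show "tensor_vec (vec_map of_int h) * tensor_vec (vec_map of_int h)
        + tensor_scalar (of_int (B h h)) \<in> ?I"
    proof (intro CollectI allI)
      fix a b
      show "P (a * (tensor_vec (vec_map of_int h) * tensor_vec (vec_map of_int h)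
        + tensor_scalar (of_int (B h h))) * b)"
        using lmult [OF relation, of a h b] by (simp only: mult.assoc)
    qed
    assume "t \<in> ?I"
    then have "P ((a * s) * t * b)" "P (a * t * (s * b))" for a b
      by blast+
    then show "s * t \<in> ?I" "t * s \<in> ?I"
      by (simp_all add: mult.assoc)
  qed
  with t have "P (1 * t * 1)" by blast
  then show ?thesis by simp
qed

section \<open>Cosets as congruence classes, and the operations of the quotient\<close>

lemma mem_clifford_class_iff: "s \<in> clifford_class B t \<longleftrightarrow> s - t \<in> clifford_ideal B"
  unfolding clifford_class_def a_r_coset_def' by (auto intro!: bexI [of _ "s - t"])

lemma clifford_class_eq_iff: "clifford_class B s = clifford_class B t \<longleftrightarrow> s - t \<in> clifford_ideal B"
proof
  assume "clifford_class B s = clifford_class B t"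
  moreover have "s \<in> clifford_class B s" by (simp add: mem_clifford_class_iff)
  ultimately show "s - t \<in> clifford_ideal B" by (simp add: mem_clifford_class_iff)
next
  assume st: "s - t \<in> clifford_ideal B"
  have "u - s \<in> clifford_ideal B \<longleftrightarrow> u - t \<in> clifford_ideal B" for u
    using clifford_ideal_add [OF _ st, of "u - s"] clifford_ideal_diff [OF _ st, of "u - t"] by auto
  then show "clifford_class B s = clifford_class B t"
    by (auto simp: mem_clifford_class_iff)
qed

lemma carrier_clifford: "carrier (clifford B) = range (clifford_class B)"
  by (auto simp: clifford_def FactRing_def A_RCOSETS_def' clifford_class_def)

lemma clifford_class_in_carrier [simp]: "clifford_class B t \<in> carrier (clifford B)"
  by (simp add: carrier_clifford)

lemma clifford_class_mult [simp]:
  "clifford_class B s \<otimes>\<^bsub>clifford B\<^esub> clifford_class B t = clifford_class B (s * t)"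
  using ideal.rcoset_mult_add [OF ideal_clifford_ideal, of s t B]
  by (simp add: clifford_def FactRing_def clifford_class_def)

lemma clifford_class_add [simp]:
  "clifford_class B s \<oplus>\<^bsub>clifford B\<^esub> clifford_class B t = clifford_class B (s + t)"
  using abelian_subgroup.a_rcos_sum [OF
      abelian_subgroupI3 [OF ideal.axioms(1) [OF ideal_clifford_ideal]
      ring.is_abelian_group [OF ring_of_ring_1_type_algebra]], of s t B]
  by (simp add: clifford_def FactRing_def clifford_class_def)

lemma one_clifford [simp]: "\<one>\<^bsub>clifford B\<^esub> = clifford_class B 1"
  by (simp add: clifford_def FactRing_def clifford_class_def)

lemma zero_clifford [simp]: "\<zero>\<^bsub>clifford B\<^esub> = clifford_class B 0"
  by (auto simp add: clifford_def FactRing_def mem_clifford_class_iff)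

lemma ring_clifford: "ring (clifford B)"
  unfolding clifford_def by (rule ideal.quotient_is_ring [OF ideal_clifford_ideal])

lemma clifford_class_minus [simp]:
  "clifford_class B s \<ominus>\<^bsub>clifford B\<^esub> clifford_class B t = clifford_class B (s - t)"
proof -
  interpret ring "clifford B" by (rule ring_clifford)
  have "\<ominus>\<^bsub>clifford B\<^esub> clifford_class B t = clifford_class B (- t)"
    by (rule minus_equality) simp_all
  then show ?thesis by (simp add: a_minus_def)
qed

lemma clifford_scale_class [simp]:
  "clifford_scale B c (clifford_class B t) = clifford_class B (tensor_scalar c * t)"
  by (simp add: clifford_scale_def)

end


section \<open>Exterior identification\<close>

text \<open>Contracting h h b gives f(h) h b - h f(h) b + h h (f \<lrcorner> b), and the first two
  terms cancel. So contraction passes through the relations, for every form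
  \<open>B\<close>.\<close>

lemma contract_tensor_clifford_ideal:
  "t \<in> clifford_ideal B \<Longrightarrow> contract_tensor f t \<in> clifford_ideal B"
proof -
  \<comment> \<open>Contracting a generator times \<open>t\<close> produces a multiple of
    \<open>t\<close> itself, so the membership of \<open>t\<close> must be carried through the
    induction.\<close>
  have "t \<in> clifford_ideal B \<and> contract_tensor f t \<in> clifford_ideal B" if "t \<in> clifford_ideal B"
    using that
  proof (induction t rule: clifford_ideal_induct)
    case (relation h b)
    let ?h = "tensor_vec (vec_map of_int h)" and ?s = "tensor_scalar (of_int (B h h))"
    have "contract_tensor f ((?h * ?h + ?s) * b) = (?h * ?h + ?s) * contract_tensor f b"
      by (simp add: distrib_right mult.assoc contract_tensor_add contract_tensor_scale
          contract_tensor_vec right_diff_distrib tensor_vec_scalar_left_commute)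
    then show ?case
      by (simp add: clifford_ideal_rmult clifford_ideal_relation)
  next
    case (gen i t)
    then show ?case
      by (simp add: contract_tensor_gen clifford_ideal_lmult clifford_ideal_diff)
  qed (simp_all add: contract_tensor_add contract_tensor_scale clifford_ideal_add clifford_ideal_lmult)
  then show "t \<in> clifford_ideal B \<Longrightarrow> contract_tensor f t \<in> clifford_ideal B" by blast
qed

text \<open>Contraction preserves the exterior ideal, so the sum in \<open>contraction\<close> is
  one coset, that of any contracted representative.\<close>

lemma contraction_class:
  "contraction B h (clifford_class zero_form t) =
     clifford_class zero_form (contract_tensor (\<lambda>i. form_ext B h (axis i 1)) t)" (is "_ = clifford_class _ (?i t)")
proof (rule Set.set_eqI)
  fix u
  have "u \<in> contraction B h (clifford_class zero_form t) \<longleftrightarrow>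
      (\<exists>j\<in>clifford_ideal zero_form. \<exists>s. s - t \<in> clifford_ideal zero_form \<and> u = j + ?i s)"
    unfolding contraction_def set_add_def' by (fastforce simp: mem_clifford_class_iff)
  also have "\<dots> \<longleftrightarrow> u - ?i t \<in> clifford_ideal zero_form"
  proof
    assume "\<exists>j\<in>clifford_ideal zero_form. \<exists>s. s - t \<in> clifford_ideal zero_form \<and> u = j + ?i s"
    then obtain j s where "j \<in> clifford_ideal zero_form" "s - t \<in> clifford_ideal zero_form" "u = j + ?i s"
      by blast
    then show "u - ?i t \<in> clifford_ideal zero_form"
      using clifford_ideal_add [OF _ contract_tensor_clifford_ideal]
      by (fastforce simp: contract_tensor_diff add_diff_eq)
  next
    assume "u - ?i t \<in> clifford_ideal zero_form"
    then show "\<exists>j\<in>clifford_ideal zero_form. \<exists>s. s - t \<in> clifford_ideal zero_form \<and> u = j + ?i s"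
      by (intro bexI [of _ "u - ?i t"] exI [of _ t]) simp_all
  qed
  finally show "u \<in> contraction B h (clifford_class zero_form t) \<longleftrightarrow> u \<in> clifford_class zero_form (?i t)"
    by (simp add: mem_clifford_class_iff)
qed

text \<open>In the deformation of h h b the two mixed terms cancel and the double contraction
  vanishes, so the only change is an added scalar M(h, h). Two forms \<open>B\<close> and
  \<open>B'\<close> are allowed so that the passage from the exterior to the Clifford ideal and its
  inverse are both instances.\<close>

lemma deform_clifford_ideal:
  fixes B B' :: "int ^ 'n \<Rightarrow> int ^ 'n \<Rightarrow> int"
  assumes "\<And>h. (of_int (B' h h) :: 'k :: comm_ring_1) =
      of_int (B h h) + (\<Sum>i\<in>UNIV. \<Sum>j\<in>UNIV. of_int (h $ i) * of_int (h $ j) * M i j)"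
    and "t \<in> clifford_ideal B"
  shows "deform M t \<in> clifford_ideal B'"
  using assms(2)
proof (induction t rule: clifford_ideal_induct)
  case (relation h b)
  let ?v = "vec_map of_int h :: 'k ^ _"
  let ?h = "tensor_vec ?v"
  let ?f = "\<lambda>j. \<Sum>i\<in>UNIV. ?v $ i * M i j"
  have "(\<Sum>j\<in>UNIV. ?v $ j * ?f j) = (\<Sum>i\<in>UNIV. \<Sum>j\<in>UNIV. of_int (h $ i) * of_int (h $ j) * M i j)"
    unfolding sum_distrib_left
    by (subst sum.swap) (simp add: vec_map_def mult_ac)
  with assms(1) [of h] have B': "of_int (B' h h) = of_int (B h h) + (\<Sum>j\<in>UNIV. ?v $ j * ?f j)"
    by simp
  define d where "d = deform M b"
  define q where "q = (\<Sum>j\<in>UNIV. ?v $ j * ?f j)"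
  have "deform M (?h * (?h * b)) = ?h * (?h * d) + tensor_scalar q * d"
    unfolding deform_vec d_def [symmetric] contract_tensor_add contract_tensor_vec
      contract_tensor_contract_tensor distrib_left q_def by simp
  then have "deform M ((?h * ?h + tensor_scalar (of_int (B h h))) * b) =
      (?h * ?h + tensor_scalar (of_int (B' h h))) * deform M b"
    unfolding B' q_def [symmetric]
    by (simp add: distrib_right mult.assoc deform_add deform_scale tensor_scalar_add d_def)
  then show ?case
    by (simp add: clifford_ideal_rmult clifford_ideal_relation)
next
  case (gen i t)
  then show ?case
    by (simp add: deform_gen clifford_ideal_add clifford_ideal_lmult contract_tensor_clifford_ideal)
qed (simp_all add: deform_add deform_scale clifford_ideal_add clifford_ideal_lmult)

section \<open>The Gram matrix and the deformation that it defines\<close>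

definition gram :: "(int ^ 'n \<Rightarrow> int ^ 'n \<Rightarrow> int) \<Rightarrow> 'n \<Rightarrow> 'n \<Rightarrow> 'k :: comm_ring_1" where
  "gram B i j = of_int (B (axis i 1) (axis j 1))"

lemma form_ext_conv_gram: "form_ext B v w = (\<Sum>i\<in>UNIV. \<Sum>j\<in>UNIV. v $ i * w $ j * gram B i j)"
  by (simp add: form_ext_def gram_def)

lemma form_ext_axis_right: "form_ext B v (axis j 1) = (\<Sum>i\<in>UNIV. v $ i * gram B i j)"
proof -
  have "form_ext B v (axis j 1) = (\<Sum>i\<in>UNIV. \<Sum>k\<in>UNIV. if k = j then v $ i * gram B i k else 0)"
    unfolding form_ext_conv_gram by (intro sum.cong) (auto simp: axis_def)
  then show ?thesis by simp
qed

lemma form_ext_expand_right: "form_ext B v w = (\<Sum>j\<in>UNIV. w $ j * form_ext B v (axis j 1))"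
  unfolding form_ext_axis_right sum_distrib_left unfolding form_ext_conv_gram
  by (subst sum.swap) (simp add: mult_ac)

lemma deform_gram_clifford_ideal:
  fixes B :: "int ^ 'n \<Rightarrow> int ^ 'n \<Rightarrow> int"
  assumes "\<And>h. B h h = form_ext B h h" and "t \<in> clifford_ideal zero_form"
  shows "deform (gram B) t \<in> clifford_ideal B"
  using assms(2)
  by (rule deform_clifford_ideal [rotated]) (subst assms(1), simp add: form_ext_conv_gram gram_def)

text \<open>Resolves the definite description: the map induced by \<open>deform (gram B)\<close> has
  all required properties, and every map that has them agrees with it.\<close>

lemma exterior_identification_class:
  fixes B :: "int ^ 'n \<Rightarrow> int ^ 'n \<Rightarrow> int" and t :: "('n, 'k :: comm_ring_1) tensor"
  assumes form: "\<And>h. B h h = form_ext B h h"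
  shows "exterior_identification B (clifford_class zero_form t) = clifford_class B (deform (gram B) t)"
proof -
  let ?ext = "clifford_class zero_form :: ('n, 'k) tensor \<Rightarrow> ('n, 'k) tensor set"
    and ?cl = "clifford_class B :: ('n, 'k) tensor \<Rightarrow> ('n, 'k) tensor set"
  define M where "M = (gram B :: 'n \<Rightarrow> 'n \<Rightarrow> 'k)"
  \<comment> \<open>The negated matrix provides the inverse deformation, and with it bijectivity and
    uniqueness.\<close>
  define N where "N = (\<lambda>i j. - M i j)"
  have deform_ideal: "deform M s \<in> clifford_ideal B" if "s \<in> clifford_ideal zero_form" for s
    unfolding M_def using form that by (rule deform_gram_clifford_ideal)
  have deform_ideal': "deform N s \<in> clifford_ideal zero_form" if "s \<in> clifford_ideal B" for s
    using that
    by (rule deform_clifford_ideal [rotated])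
      (subst form, simp add: N_def M_def form_ext_conv_gram gram_def sum_negf)
  have MN: "deform M (deform N s) = s" and NM: "deform N (deform M s) = s" for s
    using deform_inverse [of N s] deform_inverse [of M s] by (simp_all add: N_def)
  have functional: "(\<lambda>i. form_ext B h (axis i 1)) = (\<lambda>j. \<Sum>i\<in>UNIV. h $ i * M i j)" for h :: "'k ^ 'n"
    by (simp add: M_def form_ext_axis_right)
  \<comment> \<open>The value on a coset is read off from a chosen representative;
    \<open>deform_ideal\<close> makes the choice irrelevant.\<close>
  define \<phi> where "\<phi> = (\<lambda>x\<in>carrier exterior. ?cl (deform M (SOME s. s \<in> x)))"
  have \<phi>: "\<phi> (?ext s) = ?cl (deform M s)" for s
  proof -
    define s' where "s' = (SOME u. u \<in> ?ext s)"
    have "s' \<in> ?ext s"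
      unfolding s'_def by (rule someI [of _ s]) (simp add: mem_clifford_class_iff)
    then have "deform M s' - deform M s \<in> clifford_ideal B"
      using deform_ideal [of "s' - s"] by (simp add: mem_clifford_class_iff deform_diff)
    then show ?thesis
      by (simp add: \<phi>_def s'_def [symmetric] clifford_class_eq_iff)
  qed
  have inj: "?ext s = ?ext u" if "?cl (deform M s) = ?cl (deform M u)" for s u
    using that deform_ideal' [of "deform M s - deform M u"]
    by (simp add: clifford_class_eq_iff deform_diff NM)
  have bij: "bij_betw \<phi> (carrier exterior) (carrier (clifford B))"
  proof (rule bij_betw_imageI)
    show "inj_on \<phi> (carrier exterior)"
    proof (rule inj_onI)
      fix x y
      assume "x \<in> carrier exterior" "y \<in> carrier exterior" and eq: "\<phi> x = \<phi> y"
      then obtain s u where xy: "x = ?ext s" "y = ?ext u"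
        unfolding carrier_clifford by blast
      show "x = y"
        unfolding xy by (rule inj) (use eq in \<open>simp only: xy \<phi>\<close>)
    qed
    show "\<phi> ` carrier exterior = carrier (clifford B)"
    proof -
      have "range (\<lambda>u. ?cl (deform M u)) = range ?cl"
        by (metis MN surjI image_image)
      then show ?thesis
        unfolding carrier_clifford image_image \<phi> .
    qed
  qed
  have "exterior_identification B = \<phi>"
    unfolding exterior_identification_def
  proof (rule the_equality, intro conjI ballI allI)
    show "\<phi> \<in> extensional (carrier exterior)" by (simp add: \<phi>_def)
    show "bij_betw \<phi> (carrier exterior) (carrier (clifford B))" by (rule bij)
    show "\<phi> \<one>\<^bsub>exterior\<^esub> = \<one>\<^bsub>clifford B\<^esub>" by (simp add: \<phi>)
    show "\<phi> (clifford_scale zero_form c x) = clifford_scale B c (\<phi> x)" if "x \<in> carrier exterior" for c x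
      using that by (auto simp: carrier_clifford \<phi> deform_scale)
    show "\<phi> (x \<oplus>\<^bsub>exterior\<^esub> y) = \<phi> x \<oplus>\<^bsub>clifford B\<^esub> \<phi> y"
      if "x \<in> carrier exterior" "y \<in> carrier exterior" for x y
      using that by (auto simp: carrier_clifford \<phi> deform_add)
    \<comment> \<open>The contraction term of \<open>deform_vec\<close> cancels against the deformed
      contraction, leaving the product with the vector.\<close>
    show "clifford_vec B h \<otimes>\<^bsub>clifford B\<^esub> \<phi> x =
        \<phi> ((clifford_vec zero_form h \<otimes>\<^bsub>exterior\<^esub> x) \<ominus>\<^bsub>exterior\<^esub> contraction B h x)"
      if "x \<in> carrier exterior" for h x
      using that
      by (auto simp: carrier_clifford \<phi> clifford_vec_def contraction_class functional deform_diff
          deform_vec deform_contract_tensor)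
  next
    fix \<psi> :: "('n, 'k) tensor set \<Rightarrow> ('n, 'k) tensor set"
    assume "\<psi> \<in> extensional (carrier exterior) \<and>
     bij_betw \<psi> (carrier exterior) (carrier (clifford B)) \<and>
     (\<forall>x\<in>carrier exterior. \<forall>y\<in>carrier exterior. \<psi> (x \<oplus>\<^bsub>exterior\<^esub> y) = \<psi> x \<oplus>\<^bsub>clifford B\<^esub> \<psi> y) \<and>
     (\<forall>c. \<forall>x\<in>carrier exterior. \<psi> (clifford_scale zero_form c x) = clifford_scale B c (\<psi> x)) \<and>
     \<psi> \<one>\<^bsub>exterior\<^esub> = \<one>\<^bsub>clifford B\<^esub> \<and>
     (\<forall>h. \<forall>x\<in>carrier exterior.
        clifford_vec B h \<otimes>\<^bsub>clifford B\<^esub> \<psi> x =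
        \<psi> ((clifford_vec zero_form h \<otimes>\<^bsub>exterior\<^esub> x) \<ominus>\<^bsub>exterior\<^esub> contraction B h x))"
    then have ext: "\<psi> \<in> extensional (carrier exterior)"
      and add: "\<And>x y. x \<in> carrier exterior \<Longrightarrow> y \<in> carrier exterior
        \<Longrightarrow> \<psi> (x \<oplus>\<^bsub>exterior\<^esub> y) = \<psi> x \<oplus>\<^bsub>clifford B\<^esub> \<psi> y"
      and scale: "\<And>c x. x \<in> carrier exterior \<Longrightarrow> \<psi> (clifford_scale zero_form c x) = clifford_scale B c (\<psi> x)"
      and one: "\<psi> \<one>\<^bsub>exterior\<^esub> = \<one>\<^bsub>clifford B\<^esub>"
      and vec: "\<And>h x. x \<in> carrier exterior \<Longrightarrow> clifford_vec B h \<otimes>\<^bsub>clifford B\<^esub> \<psi> x =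
        \<psi> ((clifford_vec zero_form h \<otimes>\<^bsub>exterior\<^esub> x) \<ominus>\<^bsub>exterior\<^esub> contraction B h x)"
      by blast+
    txt \<open>On \<open>deform N u\<close> the defining recursion is multiplication by a vector, so that induction
      applies directly.\<close>
    have \<psi>: "\<psi> (?ext (deform N u)) = ?cl u" for u
    proof (induction u rule: tensor_induct)
      case one
      then show ?case using \<open>\<psi> \<one>\<^bsub>exterior\<^esub> = \<one>\<^bsub>clifford B\<^esub>\<close> by simp
    next
      case (scale c u)
      then show ?case
        using \<open>\<And>c x. x \<in> carrier exterior \<Longrightarrow> \<psi> (clifford_scale zero_form c x) = clifford_scale B c (\<psi> x)\<close>
          [of "?ext (deform N u)" c] by (simp add: deform_scale)
    next
      case (add s u)
      then show ?case
        using \<open>\<And>x y. x \<in> carrier exterior \<Longrightarrow> y \<in> carrier exterior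
            \<Longrightarrow> \<psi> (x \<oplus>\<^bsub>exterior\<^esub> y) = \<psi> x \<oplus>\<^bsub>clifford B\<^esub> \<psi> y\<close> [of "?ext (deform N s)" "?ext (deform N u)"]
        by (simp add: deform_add)
    next
      case (gen i u)
      let ?e = "axis i 1 :: 'k ^ 'n"
      have "deform N (tensor_vec ?e * u) = tensor_vec ?e * deform N u
          - contract_tensor (\<lambda>j. \<Sum>k\<in>UNIV. ?e $ k * M k j) (deform N u)"
        by (simp add: deform_vec N_def sum_negf contract_tensor_functional_uminus)
      then show ?case
        using vec [of "?ext (deform N u)" ?e] gen
        by (simp add: clifford_vec_def contraction_class functional tensor_vec_axis)
    qed
    show "\<psi> = \<phi>"
    proof (rule extensionalityI [OF ext])
      show "\<phi> \<in> extensional (carrier exterior)" by (simp add: \<phi>_def)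
      show "\<psi> x = \<phi> x" if "x \<in> carrier exterior" for x
        using that \<psi> [of "deform M u" for u] by (auto simp: carrier_clifford \<phi> NM)
    qed
  qed
  then show ?thesis
    by (simp add: \<phi> M_def)
qed


section \<open>Bilinear forms\<close>

lemma form_ext_add_left: "form_ext B (u + v) w = form_ext B u w + form_ext B v w"
  by (simp add: form_ext_def distrib_right sum.distrib)

lemma form_ext_add_right: "form_ext B u (v + w) = form_ext B u v + form_ext B u w"
  by (simp add: form_ext_def distrib_left distrib_right sum.distrib)

lemma form_ext_scale_left: "form_ext B (c *s v) w = c * form_ext B v w"
  by (simp add: form_ext_def sum_distrib_left mult.assoc)

lemma form_ext_scale_right: "form_ext B v (c *s w) = c * form_ext B v w"
  by (simp add: form_ext_def sum_distrib_left mult_ac)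

lemma form_ext_of_real:
  "form_ext B (vec_map complex_of_real v) (vec_map complex_of_real w) = complex_of_real (form_ext B v w)"
  by (simp add: form_ext_def vec_map_def)

locale int_bilinear_form =
  fixes B :: "int ^ 'n \<Rightarrow> int ^ 'n \<Rightarrow> int"
  assumes add_left: "B (x + y) z = B x z + B y z"
    and symmetric: "B x y = B y x"
begin

lemma add_right: "B x (y + z) = B x y + B x z"
  by (metis add_left symmetric)

lemma form_ext_commute: "form_ext B v w = form_ext B w v"
  unfolding form_ext_def
  by (subst sum.swap) (simp add: symmetric mult_ac)

lemma zero_left: "B 0 z = 0"
  using add_left [of 0 0 z] by simp

lemma sum_left: "B (sum f A) z = (\<Sum>i\<in>A. B (f i) z)"
  by (induction A rule: infinite_finite_induct) (simp_all add: zero_left add_left)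

text \<open>Additivity alone yields homogeneity over the integers, by induction upwards and
  downwards from 0.\<close>

lemma axis_left: "B (axis i c) z = c * B (axis i 1) z"
proof (induction c rule: int_induct [of _ 0])
  case base
  have "axis i 0 = (0 :: int ^ 'n)" by (simp add: axis_def vec_eq_iff)
  then show ?case by (simp only: zero_left mult_zero_left)
next
  case (step1 c)
  have "axis i (c + 1) = axis i c + (axis i 1 :: int ^ 'n)" by (simp add: axis_def vec_eq_iff)
  with step1 show ?case by (simp add: add_left algebra_simps)
next
  case (step2 c)
  have "axis i c = axis i (c - 1) + (axis i 1 :: int ^ 'n)" by (simp add: axis_def vec_eq_iff)
  with step2 show ?case by (simp add: add_left algebra_simps)
qed

lemma expand_left: "B h z = (\<Sum>i\<in>UNIV. h $ i * B (axis i 1) z)"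
proof -
  have "(\<Sum>i\<in>UNIV. axis i (h $ i)) = h"
    by (simp add: vec_eq_iff axis_def)
  then have "B h z = B (\<Sum>i\<in>UNIV. axis i (h $ i)) z" by simp
  then show ?thesis by (simp only: sum_left axis_left [of _ "h $ _"])
qed

lemma eq_form_ext: "B h k = form_ext B h k"
proof -
  have "B h k = (\<Sum>i\<in>UNIV. h $ i * B k (axis i 1))"
    by (subst expand_left) (simp add: symmetric)
  also have "\<dots> = (\<Sum>i\<in>UNIV. h $ i * (\<Sum>j\<in>UNIV. k $ j * B (axis i 1) (axis j 1)))"
    by (subst expand_left [of k]) (simp add: symmetric)
  finally show ?thesis
    by (simp add: form_ext_def sum_distrib_left mult.assoc)
qed

text \<open>The relations are imposed on squares of integral vectors only. Polarizing them on pairs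
  of basis vectors gives the anticommutators of the generators, and bilinearity carries these to
  vectors with arbitrary coefficients.\<close>

lemma clifford_ideal_polar:
  fixes v w :: "'k :: comm_ring_1 ^ 'n"
  shows "tensor_vec v * tensor_vec w + tensor_vec w * tensor_vec v + tensor_scalar (2 * form_ext B v w)
    \<in> clifford_ideal B"
proof -
  let ?e = "\<lambda>i. Poly_Mapping.single [i] 1 :: ('n, 'k) tensor"
  define r where "r i j = ?e i * ?e j + ?e j * ?e i
      + tensor_scalar (2 * of_int (B (axis i 1) (axis j 1)))" for i j
  have r: "r i j \<in> clifford_ideal B" for i j
  proof -
    let ?r = "\<lambda>h. tensor_vec (vec_map of_int h) * tensor_vec (vec_map of_int h)
        + tensor_scalar (of_int (B h h)) :: ('n, 'k) tensor"
    let ?h = "axis i 1 :: int ^ 'n" and ?k = "axis j 1 :: int ^ 'n"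
    have axis: "vec_map of_int (axis l 1) = (axis l 1 :: 'k ^ 'n)" for l :: 'n
      by (simp add: vec_map_def axis_def vec_eq_iff)
    have map_add: "vec_map of_int (?h + ?k) = (axis i 1 + axis j 1 :: 'k ^ 'n)"
      by (simp add: vec_map_def axis_def vec_eq_iff)
    have "?r (?h + ?k) - ?r ?h - ?r ?k \<in> clifford_ideal B"
      by (intro clifford_ideal_diff clifford_ideal_relation)
    moreover have "?r (?h + ?k) - ?r ?h - ?r ?k = r i j"
      unfolding map_add axis tensor_vec_add tensor_vec_axis r_def
      by (simp add: add_left add_right symmetric [of ?k ?h] tensor_scalar_add algebra_simps
          flip: mult_2)
    ultimately show ?thesis by simp
  qed
  have "tensor_vec v * tensor_vec w + tensor_vec w * tensor_vec v + tensor_scalar (2 * form_ext B v w)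
      = (\<Sum>i\<in>UNIV. \<Sum>j\<in>UNIV. tensor_scalar (v $ i * w $ j) * r i j)"
  proof -
    have vw: "tensor_vec v * tensor_vec w
        = (\<Sum>i\<in>UNIV. \<Sum>j\<in>UNIV. tensor_scalar (v $ i * w $ j) * (?e i * ?e j))" for v w :: "'k ^ 'n"
      unfolding tensor_vec_conv_gens sum_product
      by (intro sum.cong refl) (simp add: tensor_scalar_mult mult.assoc gen_scalar_left_commute)
    have wv: "tensor_vec w * tensor_vec v
        = (\<Sum>i\<in>UNIV. \<Sum>j\<in>UNIV. tensor_scalar (v $ i * w $ j) * (?e j * ?e i))"
      unfolding vw by (subst sum.swap) (simp add: mult.commute)
    have "tensor_scalar (2 * form_ext B v w)
        = (\<Sum>i\<in>UNIV. \<Sum>j\<in>UNIV. tensor_scalar (v $ i * w $ j)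
            * (tensor_scalar (2 * of_int (B (axis i 1) (axis j 1))) :: ('n, 'k) tensor))"
      by (simp add: form_ext_def sum_distrib_left tensor_scalar_sum mult_ac flip: tensor_scalar_mult)
    with vw [of v w] wv show ?thesis
      by (simp add: r_def distrib_left sum.distrib)
  qed
  then show ?thesis
    by (simp add: clifford_ideal_sum clifford_ideal_lmult r)
qed

end

section \<open>Change of coefficients\<close>

lemma lookup_poly_mapping_map: "f 0 = 0 \<Longrightarrow> Poly_Mapping.lookup (Poly_Mapping.map f t) w = f (Poly_Mapping.lookup t w)"
  by (simp add: map.rep_eq when_def)

lemma poly_mapping_map_zero: "f 0 = 0 \<Longrightarrow> Poly_Mapping.map f 0 = 0"
  by (rule poly_mapping_eqI) (simp add: lookup_poly_mapping_map)

lemma poly_mapping_map_single: "f 0 = 0 \<Longrightarrow> Poly_Mapping.map f (Poly_Mapping.single w c) = Poly_Mapping.single w (f c)"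
  by (rule poly_mapping_eqI) (simp add: lookup_poly_mapping_map lookup_single when_def)

lemma poly_mapping_map_add:
  assumes "f 0 = 0" "\<And>x y. f (x + y) = f x + f y"
  shows "Poly_Mapping.map f (s + t) = Poly_Mapping.map f s + Poly_Mapping.map f t"
  by (rule poly_mapping_eqI) (simp add: assms lookup_poly_mapping_map lookup_add)

text \<open>Biadditive maps are determined by pairs of monomials. This reduces product rules for
  coefficient maps to identities between coefficients.\<close>

lemma poly_mapping_map_bilinear:
  fixes s :: "('n, 'k :: comm_ring_1) tensor" and t :: "('n, 'l :: comm_ring_1) tensor"
    and F :: "('n, 'k) tensor \<Rightarrow> ('n, 'l) tensor \<Rightarrow> ('n, 'm :: comm_ring_1) tensor"
  assumes "\<And>s s' t. F (s + s') t = F s t + F s' t" "\<And>s t t'. F s (t + t') = F s t + F s t'"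
    and "\<And>s s' t. G (s + s') t = G s t + G s' t" "\<And>s t t'. G s (t + t') = G s t + G s t'"
    and "\<And>u w c d. F (Poly_Mapping.single u c) (Poly_Mapping.single w d) =
      G (Poly_Mapping.single u c) (Poly_Mapping.single w d)"
  shows "F s t = G s t"
proof (induction s rule: tensor_singles_induct)
  case (single u c)
  show ?case
    by (induction t rule: tensor_singles_induct) (simp_all add: assms)
qed (simp add: assms)

section \<open>Real tensors, real and imaginary parts, conjugation\<close>

abbreviation tensor_of_real :: "('n, real) tensor \<Rightarrow> ('n, complex) tensor" where
  "tensor_of_real \<equiv> Poly_Mapping.map complex_of_real"

abbreviation tensor_Re :: "('n, complex) tensor \<Rightarrow> ('n, real) tensor" where
  "tensor_Re \<equiv> Poly_Mapping.map Re"

abbreviation tensor_Im :: "('n, complex) tensor \<Rightarrow> ('n, real) tensor" where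
  "tensor_Im \<equiv> Poly_Mapping.map Im"

abbreviation tensor_cnj :: "('n, complex) tensor \<Rightarrow> ('n, complex) tensor" where
  "tensor_cnj \<equiv> Poly_Mapping.map cnj"

lemma tensor_of_real_add: "tensor_of_real (s + t) = tensor_of_real s + tensor_of_real t"
  and tensor_Re_add: "tensor_Re (x + y) = tensor_Re x + tensor_Re y"
  and tensor_Im_add: "tensor_Im (x + y) = tensor_Im x + tensor_Im y"
  and tensor_cnj_add: "tensor_cnj (x + y) = tensor_cnj x + tensor_cnj y"
  by (simp_all add: poly_mapping_map_add)

lemma tensor_of_real_mult: "tensor_of_real (s * t) = tensor_of_real s * tensor_of_real t"
  by (rule poly_mapping_map_bilinear)
    (simp_all add: tensor_of_real_add algebra_simps mult_single poly_mapping_map_single)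

lemma tensor_Re_mult: "tensor_Re (s * t) = tensor_Re s * tensor_Re t - tensor_Im s * tensor_Im t"
  by (rule poly_mapping_map_bilinear)
    (simp_all add: tensor_Re_add tensor_Im_add algebra_simps mult_single poly_mapping_map_single single_diff)

lemma tensor_Im_mult: "tensor_Im (s * t) = tensor_Re s * tensor_Im t + tensor_Im s * tensor_Re t"
  by (rule poly_mapping_map_bilinear)
    (simp_all add: tensor_Re_add tensor_Im_add algebra_simps mult_single poly_mapping_map_single single_add)

lemma tensor_cnj_mult: "tensor_cnj (s * t) = tensor_cnj s * tensor_cnj t"
  by (rule poly_mapping_map_bilinear)
    (simp_all add: tensor_cnj_add algebra_simps mult_single poly_mapping_map_single)

lemma tensor_Re_of_real [simp]: "tensor_Re (tensor_of_real t) = t"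
  and tensor_Im_of_real [simp]: "tensor_Im (tensor_of_real t) = 0"
  and tensor_cnj_cnj [simp]: "tensor_cnj (tensor_cnj x) = x"
  by (rule poly_mapping_eqI, simp add: lookup_poly_mapping_map)+

lemma tensor_of_real_scalar: "tensor_of_real (tensor_scalar c) = tensor_scalar (complex_of_real c)"
  and tensor_cnj_scalar: "tensor_cnj (tensor_scalar z) = tensor_scalar (cnj z)"
  by (simp_all add: tensor_scalar_def poly_mapping_map_single)

lemma tensor_scalar_mult_conv_map: "tensor_scalar c * t = Poly_Mapping.map ((*) c) t"
  by (simp add: tensor_scalar_def zero_list_def mult_map_scale_conv_mult)

lemma tensor_complex_decomp: "x = tensor_of_real (tensor_Re x) + tensor_scalar \<i> * tensor_of_real (tensor_Im x)"
  by (rule poly_mapping_eqI)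
    (simp add: tensor_scalar_mult_conv_map lookup_add lookup_poly_mapping_map complex_eq_iff)

lemma tensor_map_vec:
  assumes "f 0 = 0" "\<And>x y. f (x + y) = f x + f y"
  shows "Poly_Mapping.map f (tensor_vec v) = tensor_vec (vec_map f v)"
proof -
  have "Poly_Mapping.map f (\<Sum>i\<in>A. Poly_Mapping.single [i] (v $ i)) =
      (\<Sum>i\<in>A. Poly_Mapping.single [i] (f (v $ i)))" for A
    by (induction A rule: infinite_finite_induct)
      (simp_all add: poly_mapping_map_zero poly_mapping_map_add poly_mapping_map_single assms)
  then show ?thesis
    by (simp add: tensor_vec_def vec_map_def)
qed

section \<open>Compatibility of the coefficient maps with ideals and cosets\<close>

lemma tensor_of_real_clifford_ideal:
  fixes B :: "int ^ 'n \<Rightarrow> int ^ 'n \<Rightarrow> int"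
  assumes "t \<in> clifford_ideal B"
  shows "tensor_of_real t \<in> clifford_ideal B"
  using assms
proof (induction t rule: clifford_ideal_induct)
  case (relation h b)
  have "vec_map complex_of_real (vec_map of_int h) = vec_map of_int h"
    by (simp add: vec_map_def)
  then show ?case
    by (simp add: tensor_of_real_mult tensor_of_real_add tensor_of_real_scalar tensor_map_vec
        clifford_ideal_rmult clifford_ideal_relation)
qed (simp_all add: tensor_of_real_add tensor_of_real_mult clifford_ideal_add clifford_ideal_lmult)

text \<open>Each part of a product involves both parts of the factors, so the two are handled
  together: the tensors with both parts in the real ideal form a two-sided ideal, and it contains
  the relations because these come from real tensors.\<close>

lemma tensor_Re_Im_clifford_ideal:
  fixes B :: "int ^ 'n \<Rightarrow> int ^ 'n \<Rightarrow> int"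
  assumes "t \<in> clifford_ideal B"
  shows "tensor_Re t \<in> clifford_ideal B \<and> tensor_Im t \<in> clifford_ideal B"
proof -
  let ?I = "{t. tensor_Re t \<in> clifford_ideal B \<and> tensor_Im t \<in> clifford_ideal B}"
  have "clifford_ideal B \<subseteq> ?I"
  proof (rule clifford_ideal_minimal)
    fix h :: "int ^ 'n"
    let ?r = "tensor_vec (vec_map of_int h) * tensor_vec (vec_map of_int h)
        + tensor_scalar (of_int (B h h)) :: ('n, real) tensor"
    have "vec_map complex_of_real (vec_map of_int h) = vec_map of_int h"
      by (simp add: vec_map_def)
    then have "tensor_vec (vec_map of_int h) * tensor_vec (vec_map of_int h)
        + tensor_scalar (of_int (B h h)) = tensor_of_real ?r"
      by (simp add: tensor_of_real_mult tensor_of_real_add tensor_of_real_scalar tensor_map_vec)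
    then show "tensor_vec (vec_map of_int h) * tensor_vec (vec_map of_int h)
        + tensor_scalar (of_int (B h h)) \<in> ?I"
      by (simp add: clifford_ideal_relation)
  next
    show "0 \<in> ?I" by (simp add: poly_mapping_map_zero)
  qed (simp_all add: tensor_Re_add tensor_Im_add tensor_Re_mult tensor_Im_mult
      clifford_ideal_add clifford_ideal_diff clifford_ideal_lmult clifford_ideal_rmult)
  with assms show ?thesis by blast
qed

lemma tensor_cnj_clifford_ideal:
  fixes B :: "int ^ 'n \<Rightarrow> int ^ 'n \<Rightarrow> int"
  assumes "t \<in> clifford_ideal B"
  shows "tensor_cnj t \<in> clifford_ideal B"
proof -
  have "tensor_cnj t = tensor_of_real (tensor_Re t) - tensor_scalar \<i> * tensor_of_real (tensor_Im t)"
    by (rule poly_mapping_eqI)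
      (simp add: tensor_scalar_mult_conv_map lookup_minus lookup_poly_mapping_map complex_eq_iff)
  with assms show ?thesis
    by (simp add: tensor_Re_Im_clifford_ideal tensor_of_real_clifford_ideal clifford_ideal_diff
        clifford_ideal_lmult)
qed

lemma clifford_of_real_class:
  "clifford_of_real B (clifford_class B t) = clifford_class B (tensor_of_real t)"
proof (rule Set.set_eqI)
  fix u
  have diff: "tensor_of_real (s - t) = tensor_of_real s - tensor_of_real t" for s
    using tensor_of_real_add [of "s - t" t] by simp
  have "u \<in> clifford_of_real B (clifford_class B t) \<longleftrightarrow>
      (\<exists>j\<in>clifford_ideal B. \<exists>s. s - t \<in> clifford_ideal B \<and> u = j + tensor_of_real s)"
    unfolding clifford_of_real_def set_add_def' by (fastforce simp: mem_clifford_class_iff)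
  also have "\<dots> \<longleftrightarrow> u - tensor_of_real t \<in> clifford_ideal B"
  proof
    assume "\<exists>j\<in>clifford_ideal B. \<exists>s. s - t \<in> clifford_ideal B \<and> u = j + tensor_of_real s"
    then obtain j s where "j \<in> clifford_ideal B" "s - t \<in> clifford_ideal B" "u = j + tensor_of_real s"
      by blast
    then show "u - tensor_of_real t \<in> clifford_ideal B"
      using clifford_ideal_add [OF _ tensor_of_real_clifford_ideal [of "s - t" B], of j]
      by (simp add: diff add_diff_eq)
  next
    assume "u - tensor_of_real t \<in> clifford_ideal B"
    then show "\<exists>j\<in>clifford_ideal B. \<exists>s. s - t \<in> clifford_ideal B \<and> u = j + tensor_of_real s"
      by (intro bexI [of _ "u - tensor_of_real t"] exI [of _ t]) simp_all
  qed
  finally show "u \<in> clifford_of_real B (clifford_class B t) \<longleftrightarrow> u \<in> clifford_class B (tensor_of_real t)"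
    by (simp add: mem_clifford_class_iff)
qed

text \<open>The lifting condition makes the image a whole coset and not just a subset of
  one.\<close>

lemma image_clifford_class:
  assumes add: "\<And>x y. f (x + y) = f x + f y" and zero: "\<And>x. x \<in> clifford_ideal B \<Longrightarrow> f x \<in> clifford_ideal B"
    and lift: "\<And>y. y \<in> clifford_ideal B \<Longrightarrow> \<exists>x\<in>clifford_ideal B. f x = y"
  shows "f ` clifford_class B t = clifford_class B (f t)"
proof (intro equalityI subsetI)
  fix y assume "y \<in> f ` clifford_class B t"
  then obtain x where x: "x - t \<in> clifford_ideal B" "y = f x"
    by (auto simp: mem_clifford_class_iff)
  moreover have "f x = f (x - t) + f t"
    using add [of "x - t" t] by simp
  ultimately show "y \<in> clifford_class B (f t)"
    using zero by (simp add: mem_clifford_class_iff)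
next
  fix y assume "y \<in> clifford_class B (f t)"
  then obtain x where "x \<in> clifford_ideal B" "f x = y - f t"
    using lift [of "y - f t"] by (auto simp: mem_clifford_class_iff)
  then show "y \<in> f ` clifford_class B t"
    by (intro image_eqI [of _ _ "x + t"]) (simp_all add: add mem_clifford_class_iff)
qed

lemma clifford_Re_class: "clifford_Re (clifford_class B t) = clifford_class B (tensor_Re t)"
  unfolding clifford_Re_def
proof (rule image_clifford_class)
  show "\<exists>x\<in>clifford_ideal B. tensor_Re x = y" if "y \<in> clifford_ideal B" for y
    using that by (intro bexI [of _ "tensor_of_real y"]) (simp_all add: tensor_of_real_clifford_ideal)
qed (simp_all add: tensor_Re_add tensor_Re_Im_clifford_ideal)

lemma clifford_Im_class: "clifford_Im (clifford_class B t) = clifford_class B (tensor_Im t)"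
  unfolding clifford_Im_def
proof (rule image_clifford_class)
  show "\<exists>x\<in>clifford_ideal B. tensor_Im x = y" if "y \<in> clifford_ideal B" for y
  proof
    \<comment> \<open>Multiplication by \<i> turns a real tensor into a purely imaginary
      lift.\<close>
    show "tensor_Im (tensor_scalar \<i> * tensor_of_real y) = y"
      by (rule poly_mapping_eqI) (simp add: tensor_scalar_mult_conv_map lookup_poly_mapping_map)
    show "tensor_scalar \<i> * tensor_of_real y \<in> clifford_ideal B"
      using that by (simp add: tensor_of_real_clifford_ideal clifford_ideal_lmult)
  qed
qed (simp_all add: tensor_Im_add tensor_Re_Im_clifford_ideal)

lemma clifford_cnj_class: "clifford_cnj (clifford_class B t) = clifford_class B (tensor_cnj t)"
  unfolding clifford_cnj_def
proof (rule image_clifford_class)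
  show "\<exists>x\<in>clifford_ideal B. tensor_cnj x = y" if "y \<in> clifford_ideal B" for y
    using that by (intro bexI [of _ "tensor_cnj y"]) (simp_all add: tensor_cnj_clifford_ideal)
qed (simp_all add: tensor_cnj_add tensor_cnj_clifford_ideal)


section \<open>The splitting by a pair of orthonormal vectors\<close>

text \<open>Each right-hand side is a combination of a a + 1, b b + 1 and a b + b a, the quantities
  that vanish in the Clifford algebra when \<open>a\<close> and \<open>b\<close> come from
  orthonormal vectors. The element \<open>j\<close> plays the role of the scalar \<i>.\<close>

lemma
  fixes a b j :: "'a :: ring_1"
  assumes j: "j * j = -1" and comm: "a * j = j * a" "b * j = j * b"
  shows rotate_isotropic: "b * a * (a + j * b) - j * (a + j * b)
      = b * (a * a + 1) + j * (b * (a * b + b * a)) - j * ((b * b + 1) * a)"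
    and rotate_isotropic_conjugate: "b * a * (a - j * b) + j * (a - j * b)
      = b * (a * a + 1) - j * (b * (a * b + b * a)) + j * ((b * b + 1) * a)"
    and isotropic_anticommutator: "(a + j * b) * (a - j * b) + (a - j * b) * (a + j * b) + 4
      = 2 * (a * a + 1) + 2 * (b * b + 1)"
proof -
  have j': "j * (j * x) = - x" for x
    using j by (metis mult.assoc mult_minus1)
  have comm': "a * (j * x) = j * (a * x)" "b * (j * x) = j * (b * x)" for x
    using comm by (metis mult.assoc)+
  note simps = distrib_left distrib_right left_diff_distrib right_diff_distrib mult.assoc j' comm' comm
  show "b * a * (a + j * b) - j * (a + j * b)
      = b * (a * a + 1) + j * (b * (a * b + b * a)) - j * ((b * b + 1) * a)"
    by (simp add: simps)
  show "b * a * (a - j * b) + j * (a - j * b)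
      = b * (a * a + 1) - j * (b * (a * b + b * a)) + j * ((b * b + 1) * a)"
    by (simp add: simps)
  show "(a + j * b) * (a - j * b) + (a - j * b) * (a + j * b) + 4
      = 2 * (a * a + 1) + 2 * (b * b + 1)"
    by (simp add: simps mult_2)
qed

lemma tensor_scalar_mult_in_clifford_ideal_iff:
  fixes c :: "'k :: field"
  assumes "c \<noteq> 0"
  shows "tensor_scalar c * t \<in> clifford_ideal B \<longleftrightarrow> t \<in> clifford_ideal B"
proof
  assume "tensor_scalar c * t \<in> clifford_ideal B"
  then have "tensor_scalar (inverse c) * (tensor_scalar c * t) \<in> clifford_ideal B"
    by (rule clifford_ideal_lmult)
  then show "t \<in> clifford_ideal B"
    using assms by (simp flip: mult.assoc tensor_scalar_mult)
qed (rule clifford_ideal_lmult)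

text \<open>Calculations are done with representatives modulo the ideal. In the application
  \<open>a\<close> and \<open>b\<close> represent the complexified \<open>e1\<close> and
  \<open>e2\<close>, so that \<open>b * a\<close> represents the Kuga-Satake element.\<close>

locale clifford_orthonormal_pair =
  fixes B :: "int ^ 'n \<Rightarrow> int ^ 'n \<Rightarrow> int" and a b :: "('n, complex) tensor"
  assumes square_a: "a * a + 1 \<in> clifford_ideal B"
    and square_b: "b * b + 1 \<in> clifford_ideal B"
    and anticommute: "a * b + b * a \<in> clifford_ideal B"
begin

definition "n = a + tensor_scalar \<i> * b"
definition "n' = a - tensor_scalar \<i> * b"

lemma tensor_scalar_i_square: "tensor_scalar \<i> * tensor_scalar \<i> = (-1 :: ('n, complex) tensor)"
  by (simp add: tensor_scalar_uminus flip: tensor_scalar_mult)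

lemmas rotation_facts =
  tensor_scalar_i_square tensor_scalar_commute [of a] tensor_scalar_commute [of b]

lemma rotate_n: "b * a * n - tensor_scalar \<i> * n \<in> clifford_ideal B"
  unfolding n_def rotate_isotropic [OF rotation_facts]
  by (intro clifford_ideal_add clifford_ideal_diff clifford_ideal_lmult clifford_ideal_rmult
      square_a square_b anticommute)

lemma rotate_n': "b * a * n' + tensor_scalar \<i> * n' \<in> clifford_ideal B"
  unfolding n'_def rotate_isotropic_conjugate [OF rotation_facts]
  by (intro clifford_ideal_add clifford_ideal_diff clifford_ideal_lmult clifford_ideal_rmult
      square_a square_b anticommute)

lemma anticommutator_n_n': "n * n' + n' * n + 4 \<in> clifford_ideal B"
  unfolding n_def n'_def isotropic_anticommutator [OF rotation_facts]
  by (intro clifford_ideal_add clifford_ideal_lmult square_a square_b)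

lemma rotate_sum:
  "b * a * (n * s + n' * t) - (tensor_scalar \<i> * (n * s) - tensor_scalar \<i> * (n' * t)) \<in> clifford_ideal B"
proof -
  have "(b * a * n - tensor_scalar \<i> * n) * s + (b * a * n' + tensor_scalar \<i> * n') * t \<in> clifford_ideal B"
    by (intro clifford_ideal_add clifford_ideal_rmult rotate_n rotate_n')
  then show ?thesis
    by (simp add: algebra_simps)
qed

text \<open>The summands belong to the different eigenvalues \<i> and -\<i> of left multiplication
  by \<open>b * a\<close>. Subtracting \<i> times the sum from its rotation therefore isolates
  -2\<i> times the second summand, and -2\<i> is invertible.\<close>

lemma sum_in_ideal:
  assumes "n * s + n' * t \<in> clifford_ideal B"
  shows "n * s \<in> clifford_ideal B" and "n' * t \<in> clifford_ideal B"
proof -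
  let ?i = "tensor_scalar \<i>"
  have "b * a * (n * s + n' * t) - ?i * (n * s + n' * t)
      - (b * a * (n * s + n' * t) - (?i * (n * s) - ?i * (n' * t))) \<in> clifford_ideal B"
    by (intro clifford_ideal_diff clifford_ideal_lmult assms rotate_sum)
  also have "b * a * (n * s + n' * t) - ?i * (n * s + n' * t)
      - (b * a * (n * s + n' * t) - (?i * (n * s) - ?i * (n' * t)))
      = tensor_scalar (- \<i> - \<i>) * (n' * t)"
    by (simp only: tensor_scalar_diff tensor_scalar_uminus) (simp add: algebra_simps)
  finally show n't: "n' * t \<in> clifford_ideal B"
    by (simp add: tensor_scalar_mult_in_clifford_ideal_iff)
  from clifford_ideal_diff [OF assms n't] show "n * s \<in> clifford_ideal B"
    by simp
qed

lemma decompose: "\<exists>s t. z - (n * s + n' * t) \<in> clifford_ideal B"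
proof -
  \<comment> \<open>Modulo the ideal n n' + n' n is -4, so z is -1/4 times (n n' + n' n) z, and this
    is already of the desired shape.\<close>
  let ?c = "tensor_scalar (- (1 / 4)) :: ('n, complex) tensor"
  have "- ?c * ((n * n' + n' * n + 4) * z) \<in> clifford_ideal B"
    by (intro clifford_ideal_lmult clifford_ideal_rmult anticommutator_n_n')
  moreover have "- ?c * (4 * z) = z"
    by (simp flip: mult.assoc tensor_scalar_mult tensor_scalar_uminus tensor_scalar_numeral)
  ultimately have "z - (n * (?c * (n' * z)) + n' * (?c * (n * z))) \<in> clifford_ideal B"
    by (simp add: distrib_left distrib_right mult.assoc tensor_scalar_left_commute [of n]
        tensor_scalar_left_commute [of n'] tensor_scalar_uminus algebra_simps)
  then show ?thesis by blast
qed

lemma clifford_class_rotate_sum: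
  "clifford_class B (b * a * (n * s + n' * t)) = clifford_class B (n * (tensor_scalar \<i> * s) + n' * (tensor_scalar (- \<i>) * t))"
  using rotate_sum [of s t]
  by (simp add: clifford_class_eq_iff tensor_scalar_uminus tensor_scalar_left_commute [of n]
      tensor_scalar_left_commute [of n'])

lemma clifford_class_sum_unique:
  assumes "clifford_class B (n * s + n' * t) = clifford_class B (n * u + n' * v)"
  shows "clifford_class B (n * s) = clifford_class B (n * u)"
    and "clifford_class B (n' * t) = clifford_class B (n' * v)"
  using sum_in_ideal [of "s - u" "t - v"] assms
  by (simp_all add: clifford_class_eq_iff algebra_simps)

lemma clifford_class_decompose:
  obtains s t where "clifford_class B z = clifford_class B (n * s + n' * t)"
  using decompose [of z] by (auto simp: clifford_class_eq_iff)

text \<open>After splitting z into n s + n' t, the eigenvalue \<i> forces -\<i> n' t and \<i> n' t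
  to agree modulo the ideal, hence n' t to lie in it.\<close>

lemma rotation_eigenspace_iff:
  "clifford_class B (b * a * z) = clifford_class B (tensor_scalar \<i> * z) \<longleftrightarrow>
    clifford_class B z \<in> range (\<lambda>t. clifford_class B (n * t))"
proof
  obtain s t where z: "clifford_class B z = clifford_class B (n * s + n' * t)"
    by (rule clifford_class_decompose)
  have mult: "clifford_class B (x * z) = clifford_class B (x * (n * s + n' * t))" for x
    using z by (simp flip: clifford_class_mult)
  have scalar: "tensor_scalar c * (n * s + n' * t) = n * (tensor_scalar c * s) + n' * (tensor_scalar c * t)" for c
    by (simp add: distrib_left tensor_scalar_left_commute [of n] tensor_scalar_left_commute [of n'])
  assume "clifford_class B (b * a * z) = clifford_class B (tensor_scalar \<i> * z)"
  then have "clifford_class B (n' * (tensor_scalar (- \<i>) * t)) = clifford_class B (n' * (tensor_scalar \<i> * t))"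
    unfolding mult clifford_class_rotate_sum scalar by (rule clifford_class_sum_unique)
  then have "tensor_scalar (- \<i>) * (n' * t) - tensor_scalar \<i> * (n' * t) \<in> clifford_ideal B"
    by (simp only: clifford_class_eq_iff tensor_scalar_left_commute [of n'])
  then have "tensor_scalar (- \<i> - \<i>) * (n' * t) \<in> clifford_ideal B"
    by (simp only: tensor_scalar_diff left_diff_distrib)
  then have "n' * t \<in> clifford_ideal B"
    by (simp add: tensor_scalar_mult_in_clifford_ideal_iff)
  with z have "clifford_class B z = clifford_class B (n * s)"
    using clifford_ideal_add [of "z - (n * s + n' * t)" B "n' * t"]
    by (simp add: clifford_class_eq_iff)
  then show "clifford_class B z \<in> range (\<lambda>t. clifford_class B (n * t))"
    by blast
next
  assume "clifford_class B z \<in> range (\<lambda>t. clifford_class B (n * t))"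
  then obtain t where z: "clifford_class B z = clifford_class B (n * t)"
    by blast
  have mult: "clifford_class B (x * z) = clifford_class B (x * (n * t))" for x
    using z by (simp flip: clifford_class_mult)
  show "clifford_class B (b * a * z) = clifford_class B (tensor_scalar \<i> * z)"
    using clifford_class_rotate_sum [of t 0] unfolding mult
    by (simp add: tensor_scalar_left_commute [of n])
qed

end

section \<open>The (2,0) part\<close>

text \<open>A functional that vanishes on \<open>L\<close> annihilates the exterior algebra of
  \<open>L\<close>, by the antiderivation rule. It will be applied with \<open>a\<close> in
  \<open>H20\<close> and \<open>L = H11\<close>.\<close>

lemma ext_power_contract:
  assumes "x \<in> ext_power k L" and "\<And>v. v \<in> L \<Longrightarrow> form_ext B a v = 0"
  shows "\<exists>t. x = clifford_class zero_form t \<and>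
    contract_tensor (\<lambda>j. form_ext B a (axis j 1)) t \<in> clifford_ideal zero_form"
  using assms(1) unfolding ext_power_def
proof (induction rule: clifford_span.induct)
  case zero
  then show ?case by (intro exI [of _ 0]) simp
next
  case (base x)
  then obtain vs where vs: "set vs \<subseteq> L"
    and x: "x = foldr (\<lambda>v x. clifford_vec zero_form v \<otimes>\<^bsub>exterior\<^esub> x) vs \<one>\<^bsub>exterior\<^esub>"
    by blast
  from vs show ?case unfolding x
  proof (induction vs)
    case Nil
    then show ?case by (intro exI [of _ 1]) simp
  next
    case (Cons v vs)
    then obtain t where t: "foldr (\<lambda>v x. clifford_vec zero_form v \<otimes>\<^bsub>exterior\<^esub> x) vs \<one>\<^bsub>exterior\<^esub> =
        clifford_class zero_form t"
      "contract_tensor (\<lambda>j. form_ext B a (axis j 1)) t \<in> clifford_ideal zero_form"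
      by auto
    have "(\<Sum>j\<in>UNIV. v $ j * form_ext B a (axis j 1)) = 0"
      using assms(2) [of v] Cons.prems by (simp flip: form_ext_expand_right)
    with t show ?case
      by (intro exI [of _ "tensor_vec v * t"])
        (simp add: clifford_vec_def contract_tensor_vec clifford_ideal_lmult clifford_ideal_uminus)
  qed
next
  case (add x y)
  then obtain s t where "x = clifford_class zero_form s" "y = clifford_class zero_form t"
    "contract_tensor (\<lambda>j. form_ext B a (axis j 1)) s \<in> clifford_ideal zero_form"
    "contract_tensor (\<lambda>j. form_ext B a (axis j 1)) t \<in> clifford_ideal zero_form"
    by blast
  then show ?case
    by (intro exI [of _ "s + t"]) (simp add: contract_tensor_add clifford_ideal_add)
next
  case (scale x c)
  then obtain t where "x = clifford_class zero_form t"
    "contract_tensor (\<lambda>j. form_ext B a (axis j 1)) t \<in> clifford_ideal zero_form"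
    by blast
  then show ?case
    by (intro exI [of _ "tensor_scalar c * t"]) (simp add: contract_tensor_scale clifford_ideal_lmult)
qed

section \<open>Consequences of the Hodge decomposition\<close>

context polarized_hodge_structure
begin

sublocale int_bilinear_form B
  by unfold_locales (rule additive symmetric)+

lemma vec_map_cnj_cnj: "vec_map cnj (vec_map cnj v) = v"
  by (simp add: vec_map_def)

text \<open>Conjugating the second argument, which preserves \<open>H11\<close>, turns Hermitian
  orthogonality into orthogonality for the bilinear form.\<close>

lemma form_ext_H20_H11:
  assumes "a \<in> H20" "v \<in> H11"
  shows "form_ext B a v = 0"
proof -
  have "vec_map cnj v \<in> H11" using assms(2) conj11 by blast
  from orthogonal(1) [OF assms(1) this] show ?thesis
    by (simp add: herm_def vec_map_cnj_cnj)
qed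

text \<open>The isotropy of \<open>H20\<close> is its Hermitian orthogonality to its conjugate
  \<open>H02\<close>.\<close>

lemma form_ext_H20_H20:
  assumes "a \<in> H20" "v \<in> H20"
  shows "form_ext B a v = 0"
proof -
  have "vec_map cnj v \<in> H02" using assms(2) conj20 by blast
  from orthogonal(2) [OF assms(1) this] show ?thesis
    by (simp add: herm_def vec_map_cnj_cnj)
qed

lemma exterior_identification_class':
  "exterior_identification B (clifford_class zero_form t) = clifford_class B (deform (gram B) t)"
  using eq_form_ext by (rule exterior_identification_class)

text \<open>Contraction by a vector of \<open>H20\<close> kills the exterior algebra of
  \<open>H11\<close>, so the correction term of the deformation lies in the ideal and wedging with
  the vector becomes Clifford multiplication by it.\<close>

lemma clifford_hodge_subset:
  assumes "x \<in> clifford_hodge B H20 H11 H02 2 0" and H20: "H20 = range (\<lambda>c. c *s v)"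
  shows "x \<in> range (\<lambda>t. clifford_class B (tensor_vec v * t))"
proof -
  from assms(1) obtain y where x: "x = exterior_identification B y"
    and y: "y \<in> exterior_hodge H20 H11 H02 2 0"
    unfolding clifford_hodge_def by blast
  from y have "\<exists>s t. y = clifford_class zero_form s \<and>
      clifford_class B (deform (gram B) s) = clifford_class B (tensor_vec v * t)"
    unfolding exterior_hodge_def
  proof (induction rule: clifford_span.induct)
    case zero
    then show ?case by (intro exI [of _ 0]) simp
  next
    case (base y)
    then obtain k c x where y: "y = clifford_vec zero_form (c *s v) \<otimes>\<^bsub>exterior\<^esub> x"
      and x: "x \<in> ext_power k H11"
      unfolding H20 by auto
    define a where "a = c *s v"
    let ?f = "\<lambda>j. form_ext B a (axis j 1)"
    have "a \<in> H20" by (auto simp: a_def H20)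
    then obtain t where t: "x = clifford_class zero_form t"
      "contract_tensor ?f t \<in> clifford_ideal zero_form"
      using ext_power_contract [OF x form_ext_H20_H11] by blast
    \<comment> \<open>The vanishing holds modulo the exterior ideal; deformation commutes with
      contraction and so carries it to the Clifford ideal.\<close>
    have contract: "contract_tensor ?f (deform (gram B) t) \<in> clifford_ideal B"
      using deform_gram_clifford_ideal [OF eq_form_ext t(2)] by (simp add: deform_contract_tensor)
    have "clifford_class B (deform (gram B) (tensor_vec a * t)) =
        clifford_class B (tensor_vec v * (tensor_scalar c * deform (gram B) t))"
    proof -
      have "deform (gram B) (tensor_vec a * t) =
          tensor_vec a * deform (gram B) t + contract_tensor ?f (deform (gram B) t)"
        by (simp only: deform_vec form_ext_axis_right)
      moreover have "tensor_vec a * deform (gram B) t = tensor_vec v * (tensor_scalar c * deform (gram B) t)"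
        by (simp add: a_def tensor_vec_scale mult.assoc tensor_vec_scalar_left_commute)
      ultimately show ?thesis
        using contract by (simp add: clifford_class_eq_iff)
    qed
    moreover have "y = clifford_class zero_form (tensor_vec a * t)"
      by (simp add: y t a_def clifford_vec_def)
    ultimately show ?case by blast
  next
    case (add x y)
    then obtain s t s' t' where "x = clifford_class zero_form s" "y = clifford_class zero_form s'"
      "clifford_class B (deform (gram B) s) = clifford_class B (tensor_vec v * t)"
      "clifford_class B (deform (gram B) s') = clifford_class B (tensor_vec v * t')"
      by blast
    then show ?case
      by (intro exI [of _ "s + s'"] exI [of _ "t + t'"])
        (simp add: deform_add distrib_left flip: clifford_class_add)
  next
    case (scale x c)
    then obtain s t where "x = clifford_class zero_form s"
      "clifford_class B (deform (gram B) s) = clifford_class B (tensor_vec v * t)"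
      by blast
    then show ?case
      by (intro exI [of _ "tensor_scalar c * s"] exI [of _ "tensor_scalar c * t"])
        (simp add: deform_scale tensor_vec_scalar_left_commute flip: clifford_scale_class)
  qed
  then show ?thesis
    using x exterior_identification_class' by auto
qed

lemma weight_one_part_eq:
  assumes H20: "H20 = range (\<lambda>c. c *s v)"
  shows "weight_one_part B H20 H11 H02 = range (\<lambda>t. clifford_class B (tensor_vec v * t))"
proof (intro equalityI subsetI)
  fix x
  assume "x \<in> weight_one_part B H20 H11 H02"
  then show "x \<in> range (\<lambda>t. clifford_class B (tensor_vec v * t))"
    unfolding weight_one_part_def
  proof (induction rule: clifford_span.induct)
    case zero
    then show ?case by (intro image_eqI [of _ _ 0]) simp_all
  next
    case (base x)
    then obtain y u where "x = y \<otimes>\<^bsub>clifford B\<^esub> clifford_class B u"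
      "y \<in> clifford_hodge B H20 H11 H02 2 0"
      unfolding carrier_clifford by blast
    then show ?case
      using clifford_hodge_subset [OF _ H20] by (fastforce simp: mult.assoc)
  next
    case (add x y)
    then obtain s t where "x = clifford_class B (tensor_vec v * s)" "y = clifford_class B (tensor_vec v * t)"
      by blast
    then show ?case
      by (intro image_eqI [of _ _ "s + t"]) (simp_all add: distrib_left)
  next
    case (scale x c)
    then obtain t where "x = clifford_class B (tensor_vec v * t)"
      by blast
    then show ?case
      by (intro image_eqI [of _ _ "tensor_scalar c * t"])
        (simp_all add: tensor_vec_scalar_left_commute)
  qed
next
  fix x
  assume "x \<in> range (\<lambda>t. clifford_class B (tensor_vec v * t))"
  then obtain t where x: "x = clifford_class B (tensor_vec v) \<otimes>\<^bsub>clifford B\<^esub> clifford_class B t"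
    by auto
  have "v = 1 *s v" by simp
  then have "v \<in> H20" unfolding H20 by blast
  \<comment> \<open>Exterior degree 0 in the \<open>H11\<close> factor shows that \<open>v\<close>
    itself has type (2,0); its right multiples then lie in the weight one part.\<close>
  moreover have "clifford_class zero_form 1 \<in> ext_power 0 H11"
    unfolding ext_power_def by (rule clifford_span.base) simp
  ultimately have "clifford_class zero_form (tensor_vec v) \<in> exterior_hodge H20 H11 H02 2 0"
    unfolding exterior_hodge_def
    by (intro clifford_span.base) (force simp: clifford_vec_def)
  moreover have "exterior_identification B (clifford_class zero_form (tensor_vec v)) = clifford_class B (tensor_vec v)"
    using deform_vec [of "gram B" v 1] by (simp add: exterior_identification_class')
  ultimately have "clifford_class B (tensor_vec v) \<in> clifford_hodge B H20 H11 H02 2 0"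
    unfolding clifford_hodge_def by (intro image_eqI) simp_all
  then show "x \<in> weight_one_part B H20 H11 H02"
    unfolding weight_one_part_def x
    by (intro clifford_span.base) (use clifford_class_in_carrier in blast)
qed

text \<open>Isotropy of a generator \<eta> makes its real and imaginary parts orthogonal and of
  equal length. An oriented orthonormal basis thus arises from them by a rotation and a scaling,
  which amounts to multiplying \<eta> by a nonzero complex number.\<close>

lemma H20_eq_isotropic_line:
  assumes "vec.dim H20 = 1" and basis: "oriented_orthonormal_basis B H20 H02 e1 e2"
  shows "H20 = range (\<lambda>c. c *s (vec_map complex_of_real e1 + \<i> *s vec_map complex_of_real e2))"
proof -
  obtain S where S: "S \<subseteq> H20" "vec.independent S" "H20 \<subseteq> vec.span S" "card S = vec.dim H20"
    using vec.basis_exists by blast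
  with assms(1) obtain \<eta> where "S = {\<eta>}"
    by (auto simp: card_1_singleton_iff)
  with S have \<eta>: "\<eta> \<in> H20" "\<eta> \<noteq> 0" "H20 \<subseteq> range (\<lambda>c. c *s \<eta>)"
    by (auto simp: vec.span_singleton vec.dependent_single)
  define R I where "R = vec_map Re \<eta>" and "I = vec_map Im \<eta>"
  have split: "\<eta> = vec_map complex_of_real R + \<i> *s vec_map complex_of_real I"
    by (simp add: R_def I_def vec_map_def vec_eq_iff complex_eq_iff)
  have "form_ext B \<eta> \<eta> = 0" by (rule form_ext_H20_H20) (rule \<eta>)+
  then have "complex_of_real (form_ext B R R) - complex_of_real (form_ext B I I)
      + 2 * \<i> * complex_of_real (form_ext B R I) = 0"
    unfolding split
    by (simp add: form_ext_add_left form_ext_add_right form_ext_scale_left form_ext_scale_right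
        form_ext_of_real form_ext_commute [of I R] algebra_simps)
  then have RR: "form_ext B R R = form_ext B I I" and RI: "form_ext B R I = 0"
    by (auto simp: complex_eq_iff)
  define m where "m = form_ext B I I"
  from basis \<eta> obtain p q r s where e1: "e1 = p *\<^sub>R R + q *\<^sub>R I" and e2: "e2 = r *\<^sub>R R + s *\<^sub>R I"
    and det: "p * s - q * r > 0"
    and orthonormal: "form_ext B e1 e1 = 1" "form_ext B e2 e2 = 1" "form_ext B e1 e2 = 0"
    unfolding oriented_orthonormal_basis_def same_orientation_def R_def I_def by blast
  have form: "form_ext B (x *\<^sub>R R + y *\<^sub>R I) (z *\<^sub>R R + w *\<^sub>R I) = (x * z + y * w) * m" for x y z w
    using RI
    by (simp add: form_ext_add_left form_ext_add_right form_ext_scale_left form_ext_scale_right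
        form_ext_commute [of I R] RR m_def algebra_simps flip: scalar_mult_eq_scaleR)
  have norm: "(p * p + q * q) * m = 1" "(r * r + s * s) * m = 1" "(p * r + q * s) * m = 0"
    using orthonormal unfolding e1 e2 form by blast+
  then have "m \<noteq> 0" by auto
  with norm have pqrs: "p * p + q * q = r * r + s * s" "p * r + q * s = 0"
    by (metis mult_right_cancel, simp)
  \<comment> \<open>Lagrange's identity determines the determinant up to sign; the orientation
    selects the positive root.\<close>
  have "(p * s - q * r)\<^sup>2 = (p * p + q * q) * (r * r + s * s) - (p * r + q * s)\<^sup>2"
    by (simp add: power2_eq_square algebra_simps)
  also have "\<dots> = (p * p + q * q)\<^sup>2"
    by (simp add: pqrs power2_eq_square)
  finally have "p * s - q * r = p * p + q * q"
    using det by (simp add: power2_eq_iff_nonneg)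
  \<comment> \<open>The left side expands to the two equal row norms minus twice the determinant.
    Its vanishing says that the matrix is that of a complex multiplication.\<close>
  then have "(p - s)\<^sup>2 + (q + r)\<^sup>2 = 0"
    using pqrs by (simp add: power2_eq_square algebra_simps)
  then have sr: "s = p" "r = - q"
    by (simp_all add: sum_power2_eq_zero_iff)
  \<comment> \<open>The factor p - \<i> q is found by comparing the coefficients of \<open>R\<close>
    and \<open>I\<close> in e1 + \<i> e2 with those in a multiple of R + \<i> I.\<close>
  define \<alpha> where "\<alpha> = Complex p (- q)"
  have "p * p + q * q \<noteq> 0" using norm by auto
  then have \<alpha>: "\<alpha> \<noteq> 0"
    by (auto simp: \<alpha>_def complex_eq_iff)
  have "vec_map complex_of_real e1 + \<i> *s vec_map complex_of_real e2 = \<alpha> *s \<eta>"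
    unfolding split e1 e2 sr \<alpha>_def
    by (simp add: vec_map_def vec_eq_iff complex_eq_iff algebra_simps)
  moreover have "H20 = range (\<lambda>c. c *s (\<alpha> *s \<eta>))"
  proof (intro equalityI subsetI)
    fix x assume "x \<in> H20"
    with \<eta> obtain c where "x = c *s \<eta>" by blast
    with \<alpha> show "x \<in> range (\<lambda>c. c *s (\<alpha> *s \<eta>))"
      by (intro image_eqI [of _ _ "c / \<alpha>"]) (simp_all add: vector_smult_assoc)
  next
    fix x assume "x \<in> range (\<lambda>c. c *s (\<alpha> *s \<eta>))"
    then show "x \<in> H20"
      using \<eta>(1) subspaces(1) by (auto intro!: vec.subspace_scale)
  qed
  ultimately show ?thesis by simp
qed

end


section \<open>Comparison of the complex structures\<close>

text \<open>Multiplication by a real element respects the splitting into real and imaginary parts,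
  so the extended operator is again a left multiplication.\<close>

lemma complex_linear_extension_kuga_satake:
  fixes B :: "int ^ 'n \<Rightarrow> int ^ 'n \<Rightarrow> int"
  shows "complex_linear_extension B (kuga_satake B e1 e2) (clifford_class B z) =
    clifford_class B (tensor_of_real (tensor_vec e2 * tensor_vec e1) * z)"
proof -
  let ?e = "tensor_vec e2 * tensor_vec e1"
  have "tensor_of_real ?e * z = tensor_of_real ?e * tensor_of_real (tensor_Re z)
      + tensor_scalar \<i> * (tensor_of_real ?e * tensor_of_real (tensor_Im z))"
    by (subst (1) tensor_complex_decomp [of z])
      (simp add: distrib_left tensor_scalar_left_commute [of "tensor_of_real ?e"])
  then show ?thesis
    by (simp add: complex_linear_extension_def kuga_satake_def clifford_vec_def clifford_Re_class
        clifford_Im_class clifford_of_real_class flip: tensor_of_real_mult)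
qed

text \<open>The real Clifford algebra embeds in the complex one, because taking real parts inverts
  the inclusion.\<close>

lemma clifford_class_of_real_eq_iff:
  fixes B :: "int ^ 'n \<Rightarrow> int ^ 'n \<Rightarrow> int"
  shows "clifford_class B (tensor_of_real s) = clifford_class B (tensor_of_real t) \<longleftrightarrow>
    clifford_class B s = clifford_class B t"
  by (metis clifford_Re_class clifford_of_real_class tensor_Re_of_real)

theorem proposition5:
  fixes B :: "int ^ 'n \<Rightarrow> int ^ 'n \<Rightarrow> int"
    and H20 H11 H02 :: "(complex ^ 'n) set"
    and e1 e2 :: "real ^ 'n"
    and W :: "('n, complex) tensor set set"
  assumes "polarized_hodge_structure B H20 H11 H02"
    and "vec.dim H20 = 1"
    and "oriented_orthonormal_basis B H20 H02 e1 e2"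
    and "W = weight_one_part B H20 H11 H02"
  shows "weight_one_decomposition B W \<and>
    (\<forall>x\<in>carrier (clifford B). kuga_satake B e1 e2 x = weight_one_structure B W x) \<and>
    W = {z \<in> carrier (clifford B).
      complex_linear_extension B (kuga_satake B e1 e2) z = clifford_scale B \<i> z}"
proof -
  interpret polarized_hodge_structure B H20 H11 H02 by fact
  define v1 v2 where "v1 = vec_map complex_of_real e1" and "v2 = vec_map complex_of_real e2"
  let ?a = "tensor_vec v1" and ?b = "tensor_vec v2"
  have form: "form_ext B v1 v1 = 1" "form_ext B v2 v2 = 1" "form_ext B v1 v2 = 0"
    using assms(3) by (simp_all add: v1_def v2_def form_ext_of_real oriented_orthonormal_basis_def)
  \<comment> \<open>Polarization with equal arguments gives twice the relation, and 2 is invertible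
    over the complex numbers.\<close>
  have square: "tensor_vec v * tensor_vec v + 1 \<in> clifford_ideal B"
    if "form_ext B v v = 1" for v :: "complex ^ 'n"
  proof -
    have "tensor_scalar 2 * (tensor_vec v * tensor_vec v + 1) \<in> clifford_ideal B"
      using clifford_ideal_polar [of v v] that
      by (simp add: tensor_scalar_numeral mult_2 algebra_simps)
    then show ?thesis
      by (subst (asm) tensor_scalar_mult_in_clifford_ideal_iff) simp_all
  qed
  interpret clifford_orthonormal_pair B ?a ?b
    using clifford_ideal_polar [of v1 v2]
    by unfold_locales (simp_all add: square form)
  define v where "v = v1 + \<i> *s v2"
  have n: "n = tensor_vec v"
    by (simp add: n_def v_def tensor_vec_add tensor_vec_scale)
  have cnj_n: "tensor_cnj n = n'"
  proof -
    have "vec_map cnj v1 = v1" "vec_map cnj v2 = v2"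
      by (simp_all add: v1_def v2_def vec_map_def)
    then show ?thesis
      by (simp add: n_def n'_def tensor_cnj_add tensor_cnj_mult tensor_cnj_scalar tensor_map_vec
          tensor_scalar_uminus)
  qed
  have W: "W = range (\<lambda>t. clifford_class B (n * t))"
    using weight_one_part_eq [OF H20_eq_isotropic_line [OF assms(2,3)]] assms(4)
    unfolding n unfolding v_def v1_def v2_def by simp
  have W': "clifford_cnj ` W = range (\<lambda>t. clifford_class B (n' * t))"
  proof -
    have "clifford_cnj ` W = (\<lambda>t. clifford_class B (n' * t)) ` range tensor_cnj"
      by (simp add: W image_image clifford_cnj_class tensor_cnj_mult cnj_n)
    \<comment> \<open>Conjugation is onto, so conjugated right factors run through all
      tensors.\<close>
    moreover have "range (tensor_cnj :: ('n, complex) tensor \<Rightarrow> _) = UNIV"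
      by (rule surjI [of _ tensor_cnj]) simp
    ultimately show ?thesis by simp
  qed
  let ?e = "tensor_vec e2 * tensor_vec e1"
  have e: "tensor_of_real ?e = ?b * ?a"
    by (simp add: tensor_of_real_mult tensor_map_vec v1_def v2_def)
  have "weight_one_decomposition B W"
    unfolding weight_one_decomposition_def
  proof (intro conjI ballI)
    show "W \<subseteq> carrier (clifford B)" "clifford_cnj ` W \<subseteq> carrier (clifford B)"
      by (auto simp: W') (auto simp: W)
    fix z :: "('n, complex) tensor set"
    assume "z \<in> carrier (clifford B)"
    then obtain s t where z: "z = clifford_class B (n * s + n' * t)"
      unfolding carrier_clifford by (metis clifford_class_decompose rangeE)
    show "\<exists>!(x, y). x \<in> W \<and> y \<in> clifford_cnj ` W \<and> z = x \<oplus>\<^bsub>clifford B\<^esub> y"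
    proof (rule ex1I [of _ "(clifford_class B (n * s), clifford_class B (n' * t))"])
      fix xy
      assume "case xy of (x, y) \<Rightarrow> x \<in> W \<and> y \<in> clifford_cnj ` W \<and> z = x \<oplus>\<^bsub>clifford B\<^esub> y"
      then obtain u w where xy: "xy = (clifford_class B (n * u), clifford_class B (n' * w))"
        and "z = clifford_class B (n * u + n' * w)"
        unfolding W' by (auto simp: W)
      with z have "clifford_class B (n * u + n' * w) = clifford_class B (n * s + n' * t)"
        by simp
      from clifford_class_sum_unique [OF this] show "xy = (clifford_class B (n * s), clifford_class B (n' * t))"
        by (simp only: xy)
    next
      show "case (clifford_class B (n * s), clifford_class B (n' * t)) of (x, y) \<Rightarrow>
        x \<in> W \<and> y \<in> clifford_cnj ` W \<and> z = x \<oplus>\<^bsub>clifford B\<^esub> y"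
        unfolding W' by (simp add: W z)
    qed
  qed
  moreover have "kuga_satake B e1 e2 x = weight_one_structure B W x" if "x \<in> carrier (clifford B)" for x
  proof -
    obtain r where x: "x = clifford_class B r"
      using \<open>x \<in> carrier (clifford B)\<close> by (auto simp: carrier_clifford)
    have kuga: "kuga_satake B e1 e2 x = clifford_class B (?e * r)"
      by (simp add: x kuga_satake_def clifford_vec_def)
    \<comment> \<open>Stated for every splitting of \<open>x\<close>: existence uses a chosen one,
      uniqueness the one supplied by a competing value \<open>y\<close>.\<close>
    have rotate: "clifford_class B (tensor_of_real (?e * r)) =
        clifford_scale B \<i> (clifford_class B (n * s)) \<oplus>\<^bsub>clifford B\<^esub>
        clifford_scale B (- \<i>) (clifford_class B (n' * t))"
      if "clifford_class B (tensor_of_real r) = clifford_class B (n * s + n' * t)" for s t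
    proof -
      have "clifford_class B (tensor_of_real (?e * r)) = clifford_class B (?b * ?a * (n * s + n' * t))"
        using that unfolding tensor_of_real_mult [of ?e] e by (simp flip: clifford_class_mult)
      then show ?thesis
        unfolding clifford_class_rotate_sum
        by (simp add: tensor_scalar_left_commute [of n] tensor_scalar_left_commute [of n'])
    qed
    show ?thesis
      unfolding weight_one_structure_def kuga
    proof (rule the_equality [symmetric], intro conjI)
      obtain s t where st: "clifford_class B (tensor_of_real r) = clifford_class B (n * s + n' * t)"
        by (rule clifford_class_decompose)
      show "\<exists>u\<in>W. \<exists>w\<in>clifford_cnj ` W.
        clifford_of_real B x = u \<oplus>\<^bsub>clifford B\<^esub> w \<and>
        clifford_of_real B (clifford_class B (?e * r)) =
          clifford_scale B \<i> u \<oplus>\<^bsub>clifford B\<^esub> clifford_scale B (- \<i>) w"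
      proof (intro bexI conjI)
        show "clifford_class B (n * s) \<in> W" "clifford_class B (n' * t) \<in> clifford_cnj ` W"
          unfolding W' by (auto simp: W)
        show "clifford_of_real B x = clifford_class B (n * s) \<oplus>\<^bsub>clifford B\<^esub> clifford_class B (n' * t)"
          by (simp add: x clifford_of_real_class st)
        show "clifford_of_real B (clifford_class B (?e * r)) =
          clifford_scale B \<i> (clifford_class B (n * s)) \<oplus>\<^bsub>clifford B\<^esub>
          clifford_scale B (- \<i>) (clifford_class B (n' * t))"
          unfolding clifford_of_real_class by (rule rotate [OF st])
      qed
    next
      fix y
      assume y: "y \<in> carrier (clifford B) \<and> (\<exists>u\<in>W. \<exists>w\<in>clifford_cnj ` W.
        clifford_of_real B x = u \<oplus>\<^bsub>clifford B\<^esub> w \<and>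
        clifford_of_real B y = clifford_scale B \<i> u \<oplus>\<^bsub>clifford B\<^esub> clifford_scale B (- \<i>) w)"
      then obtain q s t where q: "y = clifford_class B q"
        and st: "clifford_of_real B x = clifford_class B (n * s) \<oplus>\<^bsub>clifford B\<^esub> clifford_class B (n' * t)"
        and rot: "clifford_of_real B y = clifford_scale B \<i> (clifford_class B (n * s)) \<oplus>\<^bsub>clifford B\<^esub>
          clifford_scale B (- \<i>) (clifford_class B (n' * t))"
        unfolding W' unfolding W carrier_clifford by blast
      \<comment> \<open>A competing value has the same complexification as the Kuga-Satake value, so
        the two agree in the real Clifford algebra.\<close>
      have "clifford_class B (tensor_of_real q) = clifford_class B (tensor_of_real (?e * r))"
        using rot rotate [of s t] st by (simp only: q x clifford_of_real_class clifford_class_add)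
      then show "y = clifford_class B (?e * r)"
        by (simp add: q clifford_class_of_real_eq_iff)
    qed simp
  qed
  moreover have "W = {z \<in> carrier (clifford B).
      complex_linear_extension B (kuga_satake B e1 e2) z = clifford_scale B \<i> z}"
  proof -
    have "clifford_class B z \<in> W \<longleftrightarrow> complex_linear_extension B (kuga_satake B e1 e2) (clifford_class B z) =
        clifford_scale B \<i> (clifford_class B z)" for z
      unfolding complex_linear_extension_kuga_satake e clifford_scale_class rotation_eigenspace_iff W ..
    moreover have "W \<subseteq> carrier (clifford B)"
      by (auto simp: W)
    ultimately show ?thesis
      unfolding carrier_clifford by blast
  qed
  ultimately show ?thesis by blast
qed

end
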